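(* Let $n\ge 2$ and let $E\subset\mathbb{R}^n$ be a Lebesgue measurable set with $0<mes(E)<\infty$ satisfying $$\mathbf{1}_E(v)\,\mathbf{1}_E(v_* )\,(1-\mathbf{1}_E(v'))\,(1-\mathbf{1}_E(v_*'))=0\qquad\text{for a.e. }(v,v_*,\sigma)\in\mathbb{R}^n\times\mathbb{R}^n\times\mathbb{S}^{n-1},$$ where $$v'=\frac{v+v_*}{2}+\frac{|v-v_*|}{2}\sigma,\qquad v_*'=\frac{v+v_*}{2}-\frac{|v-v_*|}{2}\sigma .$$ Then there is a ball $K=B_R(v_0)\subset\mathbb{R}^n$ such that $mes\big((E\setminus K)\cup(K\setminus E)\big)=0$.
   Context: $mes$ is Lebesgue measure on $\mathbb{R}^n$; $\mathbf{1}_E$ is the indicator function of $E$; $\mathbb{S}^{n-1}$ is the unit sphere of $\mathbb{R}^n$ with its usual area measure $d\sigma$; "a.e." is with respect to the product measure $dv\,dv_*\,d\sigma$. $B_R(v_0)=\{y\in\mathbb{R}^n:|y-v_0|\le R\}$ with $v_0\in\mathbb{R}^n$, $R>0$. *)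

theory Defs
  imports "HOL-Analysis.Analysis"
begin

(* The usual area measure on the unit sphere, obtained from Lebesgue measure by polar coordinates:
   sigma(A) = n * mes {r u | 0 < r < 1, u in A}, where n is the dimension. The factor n is
   1 / integral of r^(n-1) over (0,1). The origin is removed so that x / |x| lies on the sphere. *)
definition sphere_measure :: "'a::euclidean_space measure" where
  "sphere_measure =
     scale_measure (of_nat DIM('a))
       (distr (restrict_space lborel (ball 0 1 - {0}))
              (restrict_space borel (sphere 0 1))
              (\<lambda>x. x /\<^sub>R norm x))"

lemma space_sphere_measure: "space (sphere_measure :: 'a::euclidean_space measure) = sphere 0 1"
  by (simp add: sphere_measure_def space_scale_measure space_restrict_space)

lemma sets_sphere_measure:
  "sets (sphere_measure :: 'a::euclidean_space measure) = sets (restrict_space borel (sphere 0 1))"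
  by (simp add: sphere_measure_def)

lemma measurable_normalize:
  "(\<lambda>x::'a::euclidean_space. x /\<^sub>R norm x)
     \<in> restrict_space lborel (ball 0 1 - {0}) \<rightarrow>\<^sub>M restrict_space borel (sphere 0 1)"
  by (intro measurable_restrict_space3) auto

lemma emeasure_sphere_measure:
  fixes A :: "'a::euclidean_space set"
  assumes "A \<in> sets (restrict_space borel (sphere 0 1))"
  shows "emeasure sphere_measure A =
           of_nat DIM('a) * emeasure lborel {x \<in> ball 0 1 - {0}. x /\<^sub>R norm x \<in> A}"
proof -
  let ?B = "{x \<in> ball 0 1 - {0}. x /\<^sub>R norm x \<in> A}"
  have eq: "(\<lambda>x. x /\<^sub>R norm x) -` A \<inter> space (restrict_space lborel (ball 0 1 - {0})) = ?B"
    by (auto simp: space_restrict_space)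
  have "emeasure (restrict_space lborel (ball 0 1 - {0})) ?B = emeasure lborel ?B"
    by (rule emeasure_restrict_space) auto
  then show ?thesis
    unfolding sphere_measure_def emeasure_scale_measure
      emeasure_distr[OF measurable_normalize assms] eq
    by simp
qed

lemma emeasure_sphere_measure_sphere:
  "emeasure sphere_measure (sphere (0::'a::euclidean_space) 1)
     = of_nat DIM('a) * emeasure lborel (ball (0::'a) 1)"
proof -
  have "{x \<in> ball 0 1 - {0::'a}. x /\<^sub>R norm x \<in> sphere 0 1} = ball 0 1 - {0}"
    by auto
  moreover have "emeasure lborel (ball 0 1 - {0::'a}) = emeasure lborel (ball (0::'a) 1)"
    by (rule emeasure_Diff_null_set) (auto intro: finite_imp_null_set_lborel)
  moreover have "sphere (0::'a) 1 \<in> sets (restrict_space borel (sphere 0 1))"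
    using sets.top[of "restrict_space borel (sphere (0::'a) 1)"] by (simp add: space_restrict_space)
  ultimately show ?thesis
    by (simp add: emeasure_sphere_measure)
qed

definition post1 :: "'a::real_normed_vector \<Rightarrow> 'a \<Rightarrow> 'a \<Rightarrow> 'a" where
  "post1 v w s = (v + w) /\<^sub>R 2 + (norm (v - w) / 2) *\<^sub>R s"

definition post2 :: "'a::real_normed_vector \<Rightarrow> 'a \<Rightarrow> 'a \<Rightarrow> 'a" where
  "post2 v w s = (v + w) /\<^sub>R 2 - (norm (v - w) / 2) *\<^sub>R s"

end

theory Submission
  imports Defs
begin

text \<open>
  Replace \<open>E\<close> by a Borel set \<open>S\<close> that agrees with it almost everywhere, and write \<open>v = c + a\<close>,
  \<open>w = c - a\<close>. The post-collisional points are then \<open>c + b\<close> and \<open>c - b\<close> with \<open>b = \<bar>a\<bar> \<sigma>\<close>, so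
  the hypothesis forbids a pattern on rectangles: one diagonal in \<open>S\<close>, the other outside \<open>S\<close>.
  Translations act continuously on \<open>S\<close> in measure, and therefore ``for almost all \<open>(c, a, \<sigma>)\<close>''
  improves to ``for all \<open>a, b\<close> of equal length and almost all \<open>c\<close>'' (\<open>crossing_free\<close>). In this form
  the two diagonals play the same part, and any countable family of rectangles can be used at once.

  \<^bold>\<open>Convexity.\<close> Suppose \<open>c + h\<close> and \<open>c - h\<close> lie in \<open>S\<close> but \<open>c\<close> does not. For every \<open>u\<close> of length \<open>\<bar>h\<bar>\<close>,
  one of \<open>c + u\<close>, \<open>c - u\<close> lies in \<open>S\<close>. If moreover \<open>c + x\<close> is in \<open>S\<close> and \<open>u\<close> is orthogonal to \<open>x\<close>, the
  rectangle with corners \<open>c, c + x, c \<plusminus> u, c + x \<plusminus> u\<close>, whose corner \<open>c\<close> is missing, puts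
  \<open>c + x \<plusminus> u\<close> into \<open>S\<close> for one of the signs. This raises \<open>\<bar>x\<bar>\<^sup>2\<close> by \<open>\<bar>h\<bar>\<^sup>2\<close>, and iterating
  it makes \<open>S\<close> unbounded. In the plane this is impossible: if \<open>w\<close> in \<open>S\<close> is very far from a core
  \<open>F0\<close> of \<open>S\<close>, rotating the diagonals from \<open>w\<close> to \<open>F0\<close> by a fixed angle produces two similar images of
  \<open>F0\<close>, and almost every point of \<open>F0\<close> has one of its two images in \<open>S\<close>. All these
  images are pairwise disjoint, and enough of them exceed the finite measure of \<open>S\<close> (\<open>crossing_free_plane_bounded\<close>). Higher
  dimensions follow by slicing with planes (\<open>crossing_free_midpoint\<close>). A set of finite measure
  that contains almost all midpoints agrees almost everywhere with an open convex set \<open>U\<close>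
  (\<open>AE_midpoint_convex_imp_open_convex\<close>), and \<open>U\<close> is bounded because its measure is finite.

  \<^bold>\<open>Roundness.\<close> On the compact set \<open>A = closure U\<close> the rectangle rule holds pointwise: if the ends of one
  diagonal lie in \<open>A\<close>, so does an end of the other. For a unit vector \<open>e\<close>, take a highest and a
  lowest point of \<open>A\<close> in direction \<open>e\<close> and complete them to a rectangle with a side parallel to \<open>e\<close>:
  the width of \<open>A\<close> in direction \<open>e\<close> is realised by a chord parallel to \<open>e\<close>. Hence the width is a constant \<open>D\<close>,
  and each \<open>e\<close> has exactly one such chord. Let \<open>M e\<close> be its midpoint. Comparing the chords
  for \<open>e\<close> and \<open>u\<close> shows that \<open>(M e - M u) \<bullet> u = 0\<close> forces \<open>M e = M u\<close>, and an extremal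
  argument along great circles then makes \<open>M\<close> constant. So \<open>A\<close> has a centre, contains the sphere of
  radius \<open>D / 2\<close> about it, and lies in the corresponding ball (\<open>sphere_of_diagonal_closed\<close>).
\<close>


section \<open>Lebesgue measure and translations\<close>

lemma lborel_distr_isometric_affine:
  fixes t :: "'a::euclidean_space"
  assumes "\<bar>c\<bar> = 1"
  shows "distr lborel borel (\<lambda>x. t + c *\<^sub>R x) = lborel"
  using lborel_affine[of c t] assms by (auto simp: density_1)

lemma emeasure_lborel_translate:
  fixes t :: "'a::euclidean_space"
  assumes [measurable]: "S \<in> sets borel"
  shows "emeasure lborel {x. x + t \<in> S} = emeasure lborel S"
proof -
  have "emeasure lborel S = emeasure (distr lborel borel (\<lambda>x. t + 1 *\<^sub>R x)) S"
    by (subst lborel_distr_isometric_affine) auto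
  also have "\<dots> = emeasure lborel {x. x + t \<in> S}"
    by (subst emeasure_distr) (auto simp: vimage_def add.commute)
  finally show ?thesis by simp
qed

lemma emeasure_lborel_reflect:
  fixes t :: "'a::euclidean_space"
  assumes [measurable]: "S \<in> sets borel"
  shows "emeasure lborel {x. t - x \<in> S} = emeasure lborel S"
proof -
  have "emeasure lborel S = emeasure (distr lborel borel (\<lambda>x. t + (- 1) *\<^sub>R x)) S"
    by (subst lborel_distr_isometric_affine) auto
  also have "\<dots> = emeasure lborel {x. t - x \<in> S}"
    by (subst emeasure_distr) (auto simp: vimage_def)
  finally show ?thesis by simp
qed

lemma AE_lborel_affine:
  fixes t :: "'a::euclidean_space"
  assumes "c \<noteq> 0" and P: "AE x in lborel. P x"
  shows "AE x in lborel. P (t + c *\<^sub>R x)"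
proof -
  have "AE x in density (distr lborel borel (\<lambda>x. t + c *\<^sub>R x)) (\<lambda>_. ennreal (\<bar>c\<bar>^DIM('a))). P x"
    using P by (simp only: lborel_affine[OF assms(1), of t, symmetric])
  then have "AE x in distr lborel borel (\<lambda>x. t + c *\<^sub>R x). P x"
    using assms(1) by (subst (asm) AE_density) auto
  then show ?thesis by (rule AE_distrD[rotated]) simp
qed

lemma AE_lborel_translate:
  fixes t :: "'a::euclidean_space"
  assumes "AE x in lborel. P x"
  shows "AE x in lborel. P (x + t)"
  using AE_lborel_affine[of 1 P t] assms by (simp add: add.commute)

lemma AE_lborel_swap:
  fixes P :: "'a::euclidean_space \<Rightarrow> 'b::euclidean_space \<Rightarrow> bool"
  assumes "Measurable.pred (borel \<Otimes>\<^sub>M borel) (\<lambda>p. P (fst p) (snd p))"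
    and "AE x in lborel. AE y in lborel. P x y"
  shows "AE y in lborel. AE x in lborel. P x y"
proof -
  have "{x \<in> space (lborel \<Otimes>\<^sub>M lborel). P (fst x) (snd x)} \<in> sets (lborel \<Otimes>\<^sub>M lborel)"
    using assms(1) unfolding pred_def by (simp add: space_pair_measure)
  moreover have "pair_sigma_finite (lborel :: 'a measure) (lborel :: 'b measure)" ..
  ultimately show ?thesis using pair_sigma_finite.AE_commute[of lborel lborel P] assms(2) by blast
qed

lemma AE_lborel_ex:
  assumes "AE x in (lborel :: 'a::euclidean_space measure). P x" "open U" "U \<noteq> {}"
  shows "\<exists>x\<in>U. P x"
proof (rule ccontr)
  assume "\<not> ?thesis"
  then have "AE x in lborel. x \<notin> U" using assms(1) by (auto elim: eventually_mono)
  then have "U \<in> null_sets lborel" using assms(2) by (subst AE_iff_null_sets) auto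
  then show False using open_not_negligible[OF assms(2,3)]
    by (simp add: negligible_iff_null_sets null_sets_completionI)
qed

text \<open>
  Outer and inner regularity squeeze \<open>S\<close> between a compact set \<open>K\<close> and an open set \<open>U\<close> of almost the
  same measure; a translation shorter than the distance from \<open>K\<close> to the complement of \<open>U\<close> keeps \<open>K\<close> inside \<open>U\<close>.
\<close>

lemma translation_continuity:
  fixes S :: "'a::euclidean_space set"
  assumes S[measurable]: "S \<in> sets borel" and fin: "emeasure lborel S < \<infinity>" and "e > (0::real)"
  shows "\<exists>d>0. \<forall>h. norm h < d \<longrightarrow> emeasure lborel {x \<in> S. x + h \<notin> S} < e"
proof -
  have SL: "S \<in> sets lebesgue" using S by simp
  have e3: "e / 3 > 0" using \<open>e > 0\<close> by simp
  obtain U where U: "open U" "S \<subseteq> U" "emeasure lebesgue (U - S) < ennreal (e/3)"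
    by (rule sets_lebesgue_outer_open[OF SL e3])
  obtain C where C: "closed C" "C \<subseteq> S" "emeasure lebesgue (S - C) < ennreal (e/3)"
    by (rule sets_lebesgue_inner_closed[OF SL e3])
  note [measurable] = borel_open[OF U(1)] borel_closed[OF C(1)]
  have U3: "emeasure lborel (U - S) < ennreal (e/3)" and C3: "emeasure lborel (S - C) < ennreal (e/3)"
    using U(3) C(3) by simp_all
  have "(\<lambda>n. emeasure lborel (C - cball 0 (real n))) \<longlonglongrightarrow> emeasure lborel (\<Inter>n. C - cball 0 (real n))"
  proof (rule Lim_emeasure_decseq)
    show "emeasure lborel (C - cball 0 (real n)) \<noteq> \<infinity>" for n
    proof -
      have "emeasure lborel (C - cball 0 (real n)) \<le> emeasure lborel S"
        using C(2) by (intro emeasure_mono) auto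
      then show ?thesis using fin by (auto simp: top_unique)
    qed
  qed (auto simp: decseq_def)
  moreover have "(\<Inter>n. C - cball 0 (real n)) = {}"
  proof -
    have "\<exists>n. x \<notin> C - cball 0 (real n)" for x
      using real_arch_simple[of "norm x"] by auto
    then show ?thesis by blast
  qed
  ultimately have "(\<lambda>n. emeasure lborel (C - cball 0 (real n))) \<longlonglongrightarrow> 0"
    by (simp only: emeasure_empty)
  then have "\<forall>\<^sub>F n in sequentially. emeasure lborel (C - cball 0 (real n)) < ennreal (e/3)"
    by (rule order_tendstoD) (use \<open>e > 0\<close> in auto)
  then obtain n where n: "emeasure lborel (C - cball 0 (real n)) < ennreal (e/3)"
    by (auto simp: eventually_sequentially)
  define K where "K = C \<inter> cball 0 (real n)"
  have "compact K" unfolding K_def using C(1) by (intro closed_Int_compact) auto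
  moreover have "K \<subseteq> U" using C U by (auto simp: K_def)
  ultimately obtain d where d: "d > 0" "(\<Union>x\<in>K. ball x d) \<subseteq> U"
    using compact_subset_open_imp_ball_epsilon_subset[of K U] U(1) by metis
  have "emeasure lborel {x \<in> S. x + h \<notin> S} < ennreal e" if "norm h < d" for h
  proof -
    have "emeasure lborel {x \<in> S. x + h \<notin> S}
        \<le> emeasure lborel ((S - C) \<union> ((C - cball 0 (real n)) \<union> {x. x + h \<in> U - S}))"
    proof (intro emeasure_mono subsetI)
      fix x assume x: "x \<in> {x \<in> S. x + h \<notin> S}"
      have "x + h \<in> U" if "x \<in> K"
        using d(2) that \<open>norm h < d\<close> by (auto simp: subset_eq dist_norm)
      then show "x \<in> (S - C) \<union> ((C - cball 0 (real n)) \<union> {x. x + h \<in> U - S})"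
        using x by (auto simp: K_def)
    qed simp
    also have "\<dots> \<le> emeasure lborel (S - C) +
        (emeasure lborel (C - cball 0 (real n)) + emeasure lborel {x. x + h \<in> U - S})"
      by (intro order_trans[OF emeasure_subadditive] add_mono emeasure_subadditive order_refl) auto
    also have "\<dots> = emeasure lborel (S - C) +
        (emeasure lborel (C - cball 0 (real n)) + emeasure lborel (U - S))"
      by (subst emeasure_lborel_translate) auto
    also have "\<dots> < ennreal (e/3) + (ennreal (e/3) + ennreal (e/3))"
      using C3 n U3 by (intro add_strict_mono)
    also have "\<dots> = ennreal e"
      using \<open>e > 0\<close> by (simp flip: ennreal_plus)
    finally show ?thesis .
  qed
  then show ?thesis using d(1) by blast
qed

section \<open>Rectangles with crossing diagonals\<close>

text \<open>
  A crossing is a rectangle with centre \<open>c\<close> and half-diagonals \<open>a\<close>, \<open>b\<close> that has one diagonal in \<open>S\<close>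
  and the other outside. The equality of lengths that makes the parallelogram a rectangle is
  imposed in \<open>crossing_free\<close>.
\<close>

definition crossing_at :: "'a::real_vector set \<Rightarrow> 'a \<Rightarrow> 'a \<Rightarrow> 'a \<Rightarrow> bool" where
  "crossing_at S a b c \<longleftrightarrow> c + a \<in> S \<and> c - a \<in> S \<and> c + b \<notin> S \<and> c - b \<notin> S"

definition crossing_free :: "'a::euclidean_space set \<Rightarrow> bool" where
  "crossing_free S \<longleftrightarrow> (\<forall>a b. norm a = norm b \<longrightarrow> (AE c in lborel. \<not> crossing_at S a b c))"

lemma crossing_at_measurable[measurable (raw)]:
  fixes a b c :: "'b \<Rightarrow> 'a::euclidean_space"
  assumes [measurable]: "S \<in> sets borel" "a \<in> borel_measurable M" "b \<in> borel_measurable M"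
    "c \<in> borel_measurable M"
  shows "Measurable.pred M (\<lambda>x. crossing_at S (a x) (b x) (c x))"
  unfolding crossing_at_def by measurable

text \<open>
  Moving the half-diagonals slightly changes each of the four conditions only on a set of centres
  of small measure, by \<open>translation_continuity\<close>. This is what turns statements about almost all
  rectangles into statements about all shapes of rectangles.
\<close>

lemma crossing_at_AE_limit:
  fixes S :: "'a::euclidean_space set"
  assumes S[measurable]: "S \<in> sets borel" and fin: "emeasure lborel S < \<infinity>"
    and approx: "\<And>e. e > 0 \<Longrightarrow> \<exists>a' b'. norm (a' - a) < e \<and> norm (b' - b) < e \<and>
                    (AE c in lborel. \<not> crossing_at S a' b' c)"
  shows "AE c in lborel. \<not> crossing_at S a b c"
proof -
  have "emeasure lborel {c. crossing_at S a b c} \<le> 0 + ennreal e" if "e > 0" for e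
  proof -
    obtain d where d: "d > 0" "\<And>h. norm h < d \<Longrightarrow> emeasure lborel {x \<in> S. x + h \<notin> S} < ennreal (e/4)"
      using translation_continuity[OF S fin, of "e/4"] \<open>e > 0\<close> by auto
    obtain a' b' where ab: "norm (a' - a) < d" "norm (b' - b) < d"
      and ae: "AE c in lborel. \<not> crossing_at S a' b' c" using approx[OF d(1)] by blast
    let ?D = "\<lambda>h. {x \<in> S. x + h \<notin> S}"
    let ?A = "{c. c + a \<in> ?D (a' - a)}" and ?B = "{c. c + (- a) \<in> ?D (a - a')}"
    let ?C = "{c. c + b' \<in> ?D (b - b')}" and ?E = "{c. c + (- b') \<in> ?D (b' - b)}"
    have null: "emeasure lborel {c. crossing_at S a' b' c} = 0"
      using ae by (subst (asm) AE_iff_measurable[OF _ refl]) auto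
    have tr: "emeasure lborel {c. c + t \<in> ?D h} \<le> ennreal (e/4)" if "norm h < d" for t h
      by (subst emeasure_lborel_translate) (use d(2)[OF that] in auto)
    have "emeasure lborel {c. crossing_at S a b c} \<le>
       emeasure lborel ({c. crossing_at S a' b' c} \<union> (?A \<union> (?B \<union> (?C \<union> ?E))))"
      by (intro emeasure_mono) (auto simp: crossing_at_def)
    also have "\<dots> \<le> emeasure lborel {c. crossing_at S a' b' c} + (emeasure lborel ?A +
        (emeasure lborel ?B + (emeasure lborel ?C + emeasure lborel ?E)))"
      by (rule order_trans[OF emeasure_subadditive], simp, simp, intro add_mono order_refl)+
    also have "\<dots> \<le> 0 + (ennreal (e/4) + (ennreal (e/4) + (ennreal (e/4) + ennreal (e/4))))"
      using ab by (intro add_mono tr) (auto simp: null norm_minus_commute)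
    also have "\<dots> = ennreal e" using \<open>e > 0\<close> by (simp flip: ennreal_plus)
    finally show ?thesis by simp
  qed
  then have "emeasure lborel {c. crossing_at S a b c} \<le> 0"
    by (rule ennreal_le_epsilon)
  then show ?thesis by (subst AE_iff_measurable[OF _ refl]) auto
qed

section \<open>From collisions to rectangles\<close>

lemma finite_measure_sphere_measure: "finite_measure (sphere_measure :: 'a::euclidean_space measure)"
proof (rule finite_measureI)
  have "emeasure lborel (ball (0::'a) 1) < \<infinity>" by (rule emeasure_bounded_finite) simp
  then show "emeasure sphere_measure (space (sphere_measure :: 'a measure)) \<noteq> \<infinity>"
    unfolding space_sphere_measure emeasure_sphere_measure_sphere
    by (auto simp: ennreal_mult_eq_top_iff)
qed

text \<open>
  Writing \<open>\<sigma> = y / \<bar>y\<bar>\<close> with \<open>y\<close> in the unit ball lets shapes \<open>(d, \<sigma>)\<close> of rectangles be treated as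
  points \<open>(d, y)\<close> of a Euclidean space with Lebesgue measure.
\<close>

lemma AE_sphere_measure_normalize:
  assumes "AE s in (sphere_measure :: 'a::euclidean_space measure). P s"
  shows "AE y in lborel. norm y < 1 \<and> y \<noteq> 0 \<longrightarrow> P (y /\<^sub>R norm y)"
proof -
  let ?M = "distr (restrict_space lborel (ball 0 1 - {0})) (restrict_space borel (sphere 0 1))
              (\<lambda>x::'a. x /\<^sub>R norm x)"
  obtain N where N: "{x \<in> space sphere_measure. \<not> P x} \<subseteq> N" "emeasure sphere_measure N = 0"
    "N \<in> sets (sphere_measure :: 'a measure)"
    by (rule AE_E[OF assms])
  have "emeasure ?M N = 0" using N(2) by (simp add: sphere_measure_def)
  moreover have "N \<in> sets ?M" using N(3) by (simp add: sphere_measure_def)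
  moreover have "{x \<in> space ?M. \<not> P x} \<subseteq> N"
    using N(1) by (simp add: sphere_measure_def space_scale_measure)
  ultimately have "AE s in ?M. P s" by (intro AE_I)
  then have "AE y in restrict_space lborel (ball 0 1 - {0}). P (y /\<^sub>R norm y)"
    by (rule AE_distrD[OF measurable_normalize])
  then show ?thesis by (subst (asm) AE_restrict_space_iff) auto
qed

text \<open>
  In the coordinates \<open>(v, d) = (v, w - v)\<close> both post-collisional points are translates of \<open>v\<close> by an
  amount that depends only on \<open>d\<close> and \<open>\<sigma>\<close>. Hence a null set has a null preimage under the
  collision map, which allows \<open>E\<close> to be replaced by \<open>S\<close>, and Fubini gives the absence of crossings
  for almost all shapes \<open>(d, \<sigma>)\<close>. These are dense among all shapes, so
  \<open>crossing_at_AE_limit\<close> applies.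
\<close>

lemma collision_hypothesis_imp_crossing_free:
  fixes E S :: "'a::euclidean_space set"
  assumes ae: "AE (v, w, s) in completion (lborel \<Otimes>\<^sub>M lborel \<Otimes>\<^sub>M sphere_measure).
           indicat_real E v * indicat_real E w
             * (1 - indicat_real E (post1 v w s)) * (1 - indicat_real E (post2 v w s)) = 0"
    and S[measurable]: "S \<in> sets borel" and fin: "emeasure lborel S < \<infinity>"
    and ES: "AE x in lborel. x \<in> E \<longleftrightarrow> x \<in> S"
  shows "crossing_free S"
proof -
  define Q :: "'a set \<Rightarrow> 'a \<Rightarrow> 'a \<Rightarrow> 'a \<Rightarrow> bool" where
    "Q A v w s \<longleftrightarrow> \<not> (v \<in> A \<and> w \<in> A \<and> post1 v w s \<notin> A \<and> post2 v w s \<notin> A)" for A v w s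
  define n where "n y = y /\<^sub>R norm y" for y :: 'a
  have [measurable]: "n \<in> borel_measurable borel" unfolding n_def by measurable
  have sf: "sigma_finite_measure (sphere_measure :: 'a measure)"
    using finite_measure_sphere_measure by (rule finite_measure.axioms(1))
  have lb: "sigma_finite_measure (lborel :: 'a measure)" ..
  have psf1: "pair_sigma_finite (lborel :: 'a measure) (sphere_measure :: 'a measure)"
    using lb sf by (rule pair_sigma_finite.intro)
  have psf2: "pair_sigma_finite (lborel :: 'a measure) ((lborel :: 'a measure) \<Otimes>\<^sub>M (sphere_measure :: 'a measure))"
    using lb sigma_finite_pair_measure[OF lb sf]
    by (rule pair_sigma_finite.intro)
  have "AE x in lborel \<Otimes>\<^sub>M lborel \<Otimes>\<^sub>M sphere_measure. Q E (fst x) (fst (snd x)) (snd (snd x))"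
    using ae unfolding AE_completion_iff
    by (rule eventually_mono) (auto simp: Q_def indicator_def split: if_splits)
  from pair_sigma_finite.AE_pair[OF psf2 this]
  have "AE v in lborel. AE p in lborel \<Otimes>\<^sub>M sphere_measure. Q E v (fst p) (snd p)" by simp
  then have "AE v in lborel. AE w in lborel. AE s in sphere_measure. Q E v w s"
  proof eventually_elim
    case (elim v)
    from pair_sigma_finite.AE_pair[OF psf1 this] show ?case by simp
  qed
  then have QE: "AE v in lborel. AE w in lborel. AE y in lborel. norm y < 1 \<and> y \<noteq> 0 \<longrightarrow> Q E v w (n y)"
  proof eventually_elim
    case (elim v)
    then show ?case
    proof eventually_elim
      case (elim w)
      then show ?case unfolding n_def by (rule AE_sphere_measure_normalize)
    qed
  qed
  \<comment> \<open>Uniform treatment of both post-collisional points: \<open>g\<close> is their displacement from \<open>v\<close>.\<close>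
  have generic: "AE v in lborel. AE d in lborel. AE y in lborel. v + g d y \<in> E \<longleftrightarrow> v + g d y \<in> S"
    if g: "(\<lambda>p. g (fst p) (snd p)) \<in> borel_measurable borel" for g :: "'a \<Rightarrow> 'a \<Rightarrow> 'a"
  proof -
    obtain N where N: "{x \<in> space lborel. \<not> (x \<in> E \<longleftrightarrow> x \<in> S)} \<subseteq> N" "emeasure lborel N = 0" "N \<in> sets lborel"
      by (rule AE_E[OF ES])
    have [measurable]: "N \<in> sets borel" using N(3) by simp
    note [measurable] = g
    have "AE v in lborel. v \<notin> N" using N(2,3) by (intro AE_not_in) auto
    then have "AE v in lborel. v + g (fst p) (snd p) \<notin> N" for p
      by (rule AE_lborel_translate)
    then have "AE p in lborel. AE v in lborel. v + g (fst p) (snd p) \<notin> N" by simp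
    then have "AE v in lborel. AE p in (lborel :: ('a \<times> 'a) measure). v + g (fst p) (snd p) \<notin> N"
      by (rule AE_lborel_swap[rotated]) measurable
    then show ?thesis
    proof eventually_elim
      case (elim v)
      then have "AE p in (lborel \<Otimes>\<^sub>M lborel). v + g (fst p) (snd p) \<notin> N" by (simp only: lborel_prod)
      from lborel_pair.AE_pair[OF this] have "AE d in lborel. AE y in lborel. v + g d y \<notin> N" by simp
      then show ?case
      proof eventually_elim
        case (elim d)
        then show ?case by (rule eventually_mono) (use N(1) in auto)
      qed
    qed
  qed
  have g1: "AE v in lborel. AE d in lborel. AE y in lborel.
      v + (d /\<^sub>R 2 + (norm d / 2) *\<^sub>R n y) \<in> E \<longleftrightarrow> v + (d /\<^sub>R 2 + (norm d / 2) *\<^sub>R n y) \<in> S"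
    by (rule generic) (simp add: borel_prod[symmetric])
  have g2: "AE v in lborel. AE d in lborel. AE y in lborel.
      v + (d /\<^sub>R 2 - (norm d / 2) *\<^sub>R n y) \<in> E \<longleftrightarrow> v + (d /\<^sub>R 2 - (norm d / 2) *\<^sub>R n y) \<in> S"
    by (rule generic) (simp add: borel_prod[symmetric])
  have post: "post1 v (v + d) s = v + (d /\<^sub>R 2 + (norm d / 2) *\<^sub>R s)"
    "post2 v (v + d) s = v + (d /\<^sub>R 2 - (norm d / 2) *\<^sub>R s)" for v d s :: 'a
  proof -
    have "(v + (v + d)) /\<^sub>R 2 = v + d /\<^sub>R 2"
      by (simp add: scaleR_add_right flip: add.assoc scaleR_add_left)
    then show "post1 v (v + d) s = v + (d /\<^sub>R 2 + (norm d / 2) *\<^sub>R s)"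
      "post2 v (v + d) s = v + (d /\<^sub>R 2 - (norm d / 2) *\<^sub>R s)"
      by (simp_all add: post1_def post2_def)
  qed
  have Q_meas: "Measurable.pred (borel \<Otimes>\<^sub>M borel) (\<lambda>q. norm (snd (snd q)) < 1 \<and> snd (snd q) \<noteq> 0 \<longrightarrow>
      Q S (fst q) (fst q + fst (snd q)) (n (snd (snd q))))"
    unfolding Q_def post borel_prod[symmetric] by measurable
  from QE ES g1 g2
  have "AE v in lborel. AE p in lborel. norm (snd p) < 1 \<and> snd p \<noteq> 0 \<longrightarrow> Q S v (v + fst p) (n (snd p))"
  proof eventually_elim
    case (elim v)
    have "AE d in lborel. AE y in lborel. norm y < 1 \<and> y \<noteq> 0 \<longrightarrow> Q E v (d + v) (n y)"
      by (rule AE_lborel_translate[OF elim(1)])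
    moreover have "AE d in lborel. d + v \<in> E \<longleftrightarrow> d + v \<in> S"
      by (rule AE_lborel_translate[OF ES])
    ultimately have "AE d in lborel. AE y in lborel. norm y < 1 \<and> y \<noteq> 0 \<longrightarrow> Q S v (v + d) (n y)"
      using elim(3,4)
    proof eventually_elim
      case (elim d)
      note d = this(2)
      from elim(1,3,4) show ?case
      proof eventually_elim
        case (elim y)
        then show ?case using d \<open>v \<in> E \<longleftrightarrow> v \<in> S\<close>
          unfolding Q_def add.commute[of d v] post by blast
      qed
    qed
    then have "AE p in (lborel \<Otimes>\<^sub>M lborel). norm (snd p) < 1 \<and> snd p \<noteq> 0 \<longrightarrow> Q S v (v + fst p) (n (snd p))"
    proof (intro lborel_pair.AE_pair_measure)
      have "Measurable.pred borel (\<lambda>p. norm (snd p) < 1 \<and> snd p \<noteq> 0 \<longrightarrow> Q S v (v + fst p) (n (snd p)))"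
        using measurable_compose[OF measurable_Pair1' Q_meas, of v] by simp
      moreover have "sets (lborel \<Otimes>\<^sub>M lborel) = sets (borel :: ('a \<times> 'a) measure)"
        by (simp only: lborel_prod sets_lborel)
      moreover have "space (lborel \<Otimes>\<^sub>M lborel) = (UNIV :: ('a \<times> 'a) set)"
        by (simp add: space_pair_measure)
      ultimately show "{p \<in> space (lborel \<Otimes>\<^sub>M lborel). norm (snd p) < 1 \<and> snd p \<noteq> 0 \<longrightarrow> Q S v (v + fst p) (n (snd p))}
          \<in> sets (lborel \<Otimes>\<^sub>M lborel)"
        by (simp only: pred_def space_borel)
    qed simp
    then show ?case by (simp only: lborel_prod)
  qed
  then have main: "AE p in lborel. AE v in lborel. norm (snd p) < 1 \<and> snd p \<noteq> 0 \<longrightarrow> Q S v (v + fst p) (n (snd p))"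
    by (rule AE_lborel_swap[OF Q_meas])
  show ?thesis unfolding crossing_free_def
  proof (intro allI impI)
    fix a b :: 'a assume ab: "norm a = norm b"
    show "AE c in lborel. \<not> crossing_at S a b c"
    proof (rule crossing_at_AE_limit[OF S fin])
      fix e :: real assume "e > 0"
      \<comment> \<open>\<open>f\<close> sends \<open>(d, y)\<close> to the half-diagonals of the rectangle of the collision with \<open>\<sigma> = y / \<bar>y\<bar>\<close>.\<close>
      define f where "f p = (- (fst p /\<^sub>R 2), (norm (fst p) / 2) *\<^sub>R n (snd p))" for p :: "'a \<times> 'a"
      define V where "V = (UNIV :: 'a set) \<times> (ball (0::'a) 1 - {0})"
      have "open V" unfolding V_def by (intro open_Times open_UNIV open_Diff) auto
      have "continuous_on V f"
        unfolding f_def n_def V_def by (intro continuous_intros) auto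
      then have "open (V \<inter> f -` (ball a e \<times> ball b e))"
        using \<open>open V\<close> by (intro continuous_open_preimage open_Times) auto
      moreover have "V \<inter> f -` (ball a e \<times> ball b e) \<noteq> {}"
      proof -
        obtain u where u: "norm u = 1" "b = norm b *\<^sub>R u"
        proof (cases "b = 0")
          case True
          obtain u :: 'a where "norm u = 1" using vector_choose_size[of 1] by auto
          then show ?thesis using that True by simp
        next
          case False
          then show ?thesis using that[of "b /\<^sub>R norm b"] by simp
        qed
        have "f (- (2 *\<^sub>R a), (1/2) *\<^sub>R u) = (a, b)"
          using u ab by (simp add: f_def n_def)
        moreover have "(- (2 *\<^sub>R a), (1/2) *\<^sub>R u) \<in> V" using u by (auto simp: V_def)
        ultimately have "(- (2 *\<^sub>R a), (1/2) *\<^sub>R u) \<in> V \<inter> f -` (ball a e \<times> ball b e)"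
          using \<open>e > 0\<close> by simp
        then show ?thesis by blast
      qed
      ultimately have "\<exists>p \<in> V \<inter> f -` (ball a e \<times> ball b e).
          AE v in lborel. norm (snd p) < 1 \<and> snd p \<noteq> 0 \<longrightarrow> Q S v (v + fst p) (n (snd p))"
        by (rule AE_lborel_ex[OF main])
      then obtain p where p0: "p \<in> V \<inter> f -` (ball a e \<times> ball b e)"
        and ae_p: "AE v in lborel. norm (snd p) < 1 \<and> snd p \<noteq> 0 \<longrightarrow> Q S v (v + fst p) (n (snd p))"
        by (rule bexE)
      have p: "norm (snd p) < 1 \<and> snd p \<noteq> 0" "f p \<in> ball a e \<times> ball b e"
        using p0 by (simp_all add: V_def mem_Times_iff)
      define d where "d = fst p"
      define s where "s = n (snd p)"
      have "AE v in lborel. Q S v (v + d) s" using ae_p p(1) by (simp add: d_def s_def)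
      then have "AE c in lborel. Q S (c + - (d /\<^sub>R 2)) (c + - (d /\<^sub>R 2) + d) s"
        by (rule AE_lborel_translate)
      then have "AE c in lborel. \<not> crossing_at S (- (d /\<^sub>R 2)) ((norm d / 2) *\<^sub>R s) c"
      proof eventually_elim
        case (elim c)
        have "d /\<^sub>R 2 + d /\<^sub>R 2 = d" by (simp flip: scaleR_add_left)
        then have "c + - (d /\<^sub>R 2) + d = c - - (d /\<^sub>R 2)" by (simp add: algebra_simps)
        moreover have "c + - (d /\<^sub>R 2) + (d /\<^sub>R 2 + x) = c + x"
          "c + - (d /\<^sub>R 2) + (d /\<^sub>R 2 - x) = c - x" for x by simp_all
        ultimately show ?case using elim unfolding Q_def post crossing_at_def by metis
      qed
      moreover have "norm (- (d /\<^sub>R 2) - a) < e" "norm ((norm d / 2) *\<^sub>R s - b) < e"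
        using p(2) by (simp_all add: f_def d_def s_def dist_norm norm_minus_commute)
      ultimately show "\<exists>a' b'. norm (a' - a) < e \<and> norm (b' - b) < e \<and>
          (AE c in lborel. \<not> crossing_at S a' b' c)" by blast
    qed
  qed
qed

section \<open>Midpoint convexity in the plane\<close>

definition rot :: "real^2 \<Rightarrow> real^2" where
  "rot z = (\<chi> i. if i = 1 then - z $ 2 else z $ 1)"

lemma rot_nth [simp]: "rot z $ 1 = - z $ 2" "rot z $ 2 = z $ 1"
  by (simp_all add: rot_def)

lemma rot_linear: "linear rot"
  by (rule linearI) (simp_all add: vec_eq_iff forall_2)

lemma rot_simps [simp]:
  "rot (x + y) = rot x + rot y" "rot (x - y) = rot x - rot y" "rot (- x) = - rot x"
  "rot (c *\<^sub>R x) = c *\<^sub>R rot x" "rot 0 = 0"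
  by (simp_all add: vec_eq_iff forall_2)

lemma rot_measurable [measurable]: "rot \<in> borel_measurable borel"
  using rot_linear by (intro borel_measurable_continuous_onI linear_continuous_on)
    (simp add: linear_conv_bounded_linear)

lemma inner_rot: "z \<bullet> rot z = 0" "rot z \<bullet> z = 0" "rot z \<bullet> rot z = z \<bullet> z"
  by (simp_all add: inner_vec_def sum_2)

lemma norm_rot_comb: "norm (p *\<^sub>R z + q *\<^sub>R rot z) = sqrt (p\<^sup>2 + q\<^sup>2) * norm z"
proof -
  have "(p *\<^sub>R z + q *\<^sub>R rot z) \<bullet> (p *\<^sub>R z + q *\<^sub>R rot z) = (p\<^sup>2 + q\<^sup>2) * (z \<bullet> z)"
    by (simp add: inner_add_left inner_add_right inner_rot power2_eq_square algebra_simps)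
  then show ?thesis by (simp add: norm_eq_sqrt_inner real_sqrt_mult)
qed

text \<open>
  The map \<open>p + q rot\<close> is multiplication by the complex number \<open>p + q i\<close>, hence a similarity with
  determinant \<open>p\<^sup>2 + q\<^sup>2\<close>.
\<close>

lemma measure_similarity_le:
  fixes A B :: "(real^2) set"
  assumes A: "A \<in> sets borel" "emeasure lborel A < \<infinity>" and B: "B \<in> sets borel" "emeasure lborel B < \<infinity>"
    and sub: "\<And>v. v \<in> A \<Longrightarrow> w + p *\<^sub>R (v - w) + q *\<^sub>R rot (v - w) \<in> B"
  shows "(p\<^sup>2 + q\<^sup>2) * measure lborel A \<le> measure lborel B"
proof -
  define f where "f z = p *\<^sub>R z + q *\<^sub>R rot z" for z
  have lin: "linear f" by (rule linearI) (simp_all add: f_def algebra_simps)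
  have AL: "A \<in> lmeasurable" and BL: "B \<in> lmeasurable"
    using A B by (auto intro!: fmeasurableI)
  have "det (matrix f) = p\<^sup>2 + q\<^sup>2"
    by (simp add: det_2 matrix_def f_def axis_def power2_eq_square)
  then have m: "measure lebesgue (f ` A) = (p\<^sup>2 + q\<^sup>2) * measure lebesgue A"
    using measure_linear_image[OF lin AL] by simp
  define t where "t = w - f w"
  have "(\<lambda>x. t + x) ` (f ` A) \<subseteq> B"
    using sub by (auto simp: t_def f_def algebra_simps)
  then have "measure lebesgue ((\<lambda>x. t + x) ` (f ` A)) \<le> measure lebesgue B"
    using measurable_linear_image[OF lin AL] BL
    by (intro measure_mono_fmeasurable) (auto intro: fmeasurableD measurable_translation)
  then have "(p\<^sup>2 + q\<^sup>2) * measure lebesgue A \<le> measure lebesgue B"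
    by (simp add: measure_translation m)
  then show ?thesis using A B by simp
qed

text \<open>
  The second diagonal is the first one rotated by the unit complex number \<open>\<omega> = x + y i\<close>. Its ends are
  \<open>w + \<zeta> (v - w)\<close> and \<open>w + (1 - \<zeta>) (v - w)\<close> with \<open>\<zeta> = (1 + \<omega>) / 2\<close>; for fixed \<open>w\<close> they
  depend on \<open>v\<close> through similarities.
\<close>

lemma crossing_free_rotated:
  fixes F :: "(real^2) set"
  assumes F[measurable]: "F \<in> sets borel" and cf: "crossing_free F" and xy: "x\<^sup>2 + y\<^sup>2 = 1"
  shows "AE w in lborel. AE v in lborel. w \<in> F \<longrightarrow> v \<in> F \<longrightarrow>
     w + ((1 + x) / 2) *\<^sub>R (v - w) + (y / 2) *\<^sub>R rot (v - w) \<in> F \<or>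
     w + ((1 - x) / 2) *\<^sub>R (v - w) + (- y / 2) *\<^sub>R rot (v - w) \<in> F"
proof -
  define b where "b a = x *\<^sub>R a + y *\<^sub>R rot a" for a
  have [measurable]: "b \<in> borel_measurable borel" unfolding b_def by measurable
  have "norm (b a) = norm a" for a by (simp add: b_def norm_rot_comb xy)
  then have "AE c in lborel. \<not> crossing_at F (d /\<^sub>R 2) (b (d /\<^sub>R 2)) c" for d
    using cf unfolding crossing_free_def by auto
  then have "AE w in lborel. \<not> crossing_at F (d /\<^sub>R 2) (b (d /\<^sub>R 2)) (w + d /\<^sub>R 2)" for d
    by (rule AE_lborel_translate)
  then have "AE d in lborel. AE w in lborel. \<not> crossing_at F (d /\<^sub>R 2) (b (d /\<^sub>R 2)) (w + d /\<^sub>R 2)"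
    by simp
  then have "AE w in lborel. AE d in lborel. \<not> crossing_at F (d /\<^sub>R 2) (b (d /\<^sub>R 2)) (w + d /\<^sub>R 2)"
    by (rule AE_lborel_swap[rotated]) measurable
  then show ?thesis
  proof eventually_elim
    case (elim w)
    have "AE v in lborel. \<not> crossing_at F ((v + - w) /\<^sub>R 2) (b ((v + - w) /\<^sub>R 2)) (w + (v + - w) /\<^sub>R 2)"
      by (rule AE_lborel_translate[OF elim])
    then show ?case
    proof eventually_elim
      case (elim v)
      define d where "d = v - w"
      have eqs: "w + d /\<^sub>R 2 + d /\<^sub>R 2 = v" "w + d /\<^sub>R 2 - d /\<^sub>R 2 = w"
        "w + d /\<^sub>R 2 + b (d /\<^sub>R 2) = w + ((1 + x) / 2) *\<^sub>R d + (y / 2) *\<^sub>R rot d"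
        "w + d /\<^sub>R 2 - b (d /\<^sub>R 2) = w + ((1 - x) / 2) *\<^sub>R d + (- y / 2) *\<^sub>R rot d"
        by (simp_all add: d_def b_def vec_eq_iff forall_2 field_simps)
      have "\<not> crossing_at F (d /\<^sub>R 2) (b (d /\<^sub>R 2)) (w + d /\<^sub>R 2)"
        using elim by (simp add: d_def)
      then show ?case unfolding d_def[symmetric] crossing_at_def eqs by blast
    qed
  qed
qed

text \<open>
  Let \<open>w\<close> in \<open>F\<close> be far from the origin and let \<open>F0\<close> be the part of \<open>F\<close> in a fixed disc. For each of
  \<open>n\<close> angles, almost every \<open>v\<close> in \<open>F0\<close> is mapped into \<open>F\<close> by one of the two similarities of
  \<open>crossing_free_rotated\<close>. The \<open>2 n\<close> images of the disc have centres \<open>(1 - \<zeta>) w\<close> and \<open>\<zeta> w\<close>, which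
  move apart as \<open>w\<close> recedes, so they are disjoint and \<open>F\<close> has measure at least \<open>n / 4\<close> times that of
  \<open>F0\<close>. For large \<open>n\<close> this is absurd.
\<close>

lemma crossing_free_plane_bounded:
  fixes F :: "(real^2) set"
  assumes F[measurable]: "F \<in> sets borel" and fin: "emeasure lborel F < \<infinity>" and cf: "crossing_free F"
  shows "\<exists>R. AE x in lborel. x \<in> F \<longrightarrow> norm x \<le> R"
proof (cases "\<forall>n. F \<inter> ball 0 (real n) \<in> null_sets lborel")
  case True
  then have "(\<Union>n. F \<inter> ball 0 (real n)) \<in> null_sets lborel" by blast
  moreover have "(\<Union>n. F \<inter> ball 0 (real n)) = F"
    using reals_Archimedean2 by fastforce
  ultimately have "F \<in> null_sets lborel" by (simp only:)
  then have "AE x in lborel. x \<notin> F" by (rule AE_not_in)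
  then show ?thesis by (intro exI[of _ 0]) (auto elim: eventually_mono)
next
  case False
  then obtain n0 where n0: "F \<inter> ball 0 (real n0) \<notin> null_sets lborel" by blast
  define \<rho> where "\<rho> = real n0"
  define F0 where "F0 = F \<inter> ball 0 \<rho>"
  have [measurable]: "F0 \<in> sets borel" by (simp add: F0_def)
  have finite_sub: "emeasure lborel A < \<infinity>" if "A \<subseteq> F" "A \<in> sets borel" for A
    using emeasure_mono[of A F lborel] that fin by (simp add: le_less_trans)
  have F0fin: "emeasure lborel F0 < \<infinity>" by (rule finite_sub) (auto simp: F0_def)
  have "emeasure lborel F0 \<noteq> 0" using n0 by (auto simp: F0_def \<rho>_def null_sets_def)
  then have \<mu>: "measure lborel F0 > 0"
    using F0fin by (simp add: measure_def enn2real_positive_iff zero_less_iff_neq_zero)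
  obtain n :: nat where n: "real n * measure lborel F0 > 4 * measure lborel F"
    using ex_less_of_nat_mult[OF \<mu>] by auto
  have n_pos: "n > 0" using n measure_nonneg[of lborel F] by (cases n) auto
  \<comment> \<open>Real parts in \<open>[0, 1/2]\<close> keep both factors \<open>\<bar>\<zeta>\<bar>\<^sup>2\<close> and \<open>\<bar>1 - \<zeta>\<bar>\<^sup>2\<close> at least \<open>1/4\<close>.\<close>
  define x where "x j = real j / (2 * real n)" for j
  define y where "y j = sqrt (1 - (x j)\<^sup>2)" for j
  have x: "0 \<le> x j" "x j \<le> 1/2" if "j < n" for j
    using that n_pos by (auto simp: x_def field_simps)
  have xsq: "(x j)\<^sup>2 \<le> 1/4" if "j < n" for j
    using power_mono[OF x(2)[OF that] x(1)[OF that], of 2] by (simp add: power2_eq_square)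
  have y: "(x j)\<^sup>2 + (y j)\<^sup>2 = 1" "y j \<ge> 1/2" if "j < n" for j
  proof -
    show "(x j)\<^sup>2 + (y j)\<^sup>2 = 1" using xsq[OF that] by (simp add: y_def)
    show "y j \<ge> 1/2" unfolding y_def using xsq[OF that]
      by (intro real_le_rsqrt) (simp add: power2_eq_square)
  qed
  define p where "p i = (if snd i then (1 + x (fst i)) / 2 else (1 - x (fst i)) / 2)" for i :: "nat \<times> bool"
  define q where "q i = (if snd i then y (fst i) / 2 else - y (fst i) / 2)" for i :: "nat \<times> bool"
  define f where "f i w v = w + p i *\<^sub>R (v - w) + q i *\<^sub>R rot (v - w)" for i w v
  define I where "I = {..<n} \<times> (UNIV :: bool set)"
  have pq: "1/4 \<le> (p i)\<^sup>2 + (q i)\<^sup>2" "(p i)\<^sup>2 + (q i)\<^sup>2 \<le> 1" if "i \<in> I" for i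
  proof -
    have i: "fst i < n" using that by (auto simp: I_def)
    have "(p i)\<^sup>2 + (q i)\<^sup>2 = (if snd i then (1 + x (fst i)) / 2 else (1 - x (fst i)) / 2)"
      using y(1)[OF i] by (simp add: p_def q_def power2_eq_square field_simps)
    then show "1/4 \<le> (p i)\<^sup>2 + (q i)\<^sup>2" "(p i)\<^sup>2 + (q i)\<^sup>2 \<le> 1" using x[OF i] by (auto split: if_splits)
  qed
  have sep: "1 / (4 * real n) \<le> sqrt ((p i - p j)\<^sup>2 + (q i - q j)\<^sup>2)" if "i \<in> I" "j \<in> I" "i \<noteq> j" for i j
  proof (cases "snd i = snd j")
    case True
    then have "fst i \<noteq> fst j" using that(3) by (auto simp: prod_eq_iff)
    then have "1 \<le> \<bar>real (fst i) - real (fst j)\<bar>" by linarith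
    moreover have "p i - p j = (if snd i then 1 else - 1) * ((real (fst i) - real (fst j)) / (4 * real n))"
      using True n_pos by (simp add: p_def x_def field_simps)
    then have "\<bar>p i - p j\<bar> = \<bar>real (fst i) - real (fst j)\<bar> / (4 * real n)"
      by (simp add: abs_mult)
    ultimately have "1 / (4 * real n) \<le> \<bar>p i - p j\<bar>"
      by (simp add: divide_right_mono)
    also have "\<dots> \<le> sqrt ((p i - p j)\<^sup>2 + (q i - q j)\<^sup>2)" by simp
    finally show ?thesis .
  next
    case False
    have "1 / (4 * real n) \<le> 1/2" using n_pos by (simp add: field_simps)
    also have "1/2 \<le> \<bar>q i - q j\<bar>"
      using False y(2)[of "fst i"] y(2)[of "fst j"] that by (auto simp: q_def I_def split: if_splits)
    also have "\<dots> \<le> sqrt ((p i - p j)\<^sup>2 + (q i - q j)\<^sup>2)" by simp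
    finally show ?thesis .
  qed
  have "AE w in lborel. \<forall>j\<in>{..<n}. AE v in lborel. w \<in> F \<longrightarrow> v \<in> F \<longrightarrow>
      f (j, True) w v \<in> F \<or> f (j, False) w v \<in> F"
    unfolding f_def p_def q_def
    by (intro AE_finite_allI) (use crossing_free_rotated[OF F cf y(1)] in auto)
  then have "AE w in lborel. w \<in> F \<longrightarrow> norm w \<le> 8 * real n * \<rho>"
  proof eventually_elim
    case (elim w)
    show ?case
    proof (intro impI, rule ccontr)
      assume w: "w \<in> F" "\<not> norm w \<le> 8 * real n * \<rho>"
      define A where "A i = {v \<in> F0. f i w v \<in> F}" for i
      define B where "B i = F \<inter> ball (w - p i *\<^sub>R w - q i *\<^sub>R rot w) \<rho>" for i
      have "f i w \<in> borel_measurable borel" for i unfolding f_def by measurable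
      then have "f i w -` F \<in> sets borel" for i by (rule measurable_sets_borel) (rule F)
      moreover have "A i = F0 \<inter> f i w -` F" for i by (auto simp: A_def)
      ultimately have [measurable]: "A i \<in> sets borel" for i by simp
      have [measurable]: "B i \<in> sets borel" for i by (simp add: B_def)
      have Afin: "emeasure lborel (A i) < \<infinity>" for i
        by (rule finite_sub, (auto simp: A_def F0_def)[1]) simp
      have Bfin: "emeasure lborel (B i) < \<infinity>" for i
        by (rule finite_sub, (auto simp: B_def)[1]) simp
      have AB: "measure lborel (A i) \<le> 4 * measure lborel (B i)" if i: "i \<in> I" for i
      proof -
        have "((p i)\<^sup>2 + (q i)\<^sup>2) * measure lborel (A i) \<le> measure lborel (B i)"
        proof (rule measure_similarity_le[where w = w])
          fix v assume v: "v \<in> A i"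
          have "norm (p i *\<^sub>R v + q i *\<^sub>R rot v) \<le> 1 * norm v"
            unfolding norm_rot_comb using pq(2)[OF i] by (intro mult_right_mono) auto
          also have "\<dots> < \<rho>" using v by (simp add: A_def F0_def)
          finally have "norm (- (p i *\<^sub>R v + q i *\<^sub>R rot v)) < \<rho>" by (simp only: norm_minus_cancel)
          moreover have "w - p i *\<^sub>R w - q i *\<^sub>R rot w - f i w v = - (p i *\<^sub>R v + q i *\<^sub>R rot v)"
            by (simp add: f_def algebra_simps)
          ultimately have "dist (w - p i *\<^sub>R w - q i *\<^sub>R rot w) (f i w v) < \<rho>"
            by (simp only: dist_norm)
          then show "w + p i *\<^sub>R (v - w) + q i *\<^sub>R rot (v - w) \<in> B i"
            using v by (simp add: A_def B_def f_def)
        qed (use Afin Bfin in auto)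
        moreover have "1/4 * measure lborel (A i) \<le> ((p i)\<^sup>2 + (q i)\<^sup>2) * measure lborel (A i)"
          using pq(1)[OF i] by (intro mult_right_mono) auto
        ultimately show ?thesis by simp
      qed
      have disj: "B i \<inter> B j = {}" if "i \<in> I" "j \<in> I" "i \<noteq> j" for i j
      proof -
        have "2 * \<rho> = 1 / (4 * real n) * (8 * real n * \<rho>)" using n_pos by simp
        also have "\<dots> \<le> sqrt ((p j - p i)\<^sup>2 + (q j - q i)\<^sup>2) * norm w"
          using w(2) sep[of j i] that n_pos by (intro mult_mono) (auto simp: \<rho>_def)
        also have "\<dots> = norm ((p j - p i) *\<^sub>R w + (q j - q i) *\<^sub>R rot w)" by (simp add: norm_rot_comb)
        also have "\<dots> = dist (w - p i *\<^sub>R w - q i *\<^sub>R rot w) (w - p j *\<^sub>R w - q j *\<^sub>R rot w)"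
          by (simp add: dist_norm algebra_simps)
        finally have "ball (w - p i *\<^sub>R w - q i *\<^sub>R rot w) \<rho> \<inter> ball (w - p j *\<^sub>R w - q j *\<^sub>R rot w) \<rho> = {}"
          by (intro disjoint_ballI) simp
        then show ?thesis by (auto simp: B_def)
      qed
      have cover: "measure lborel F0 \<le> measure lborel (A (j, True)) + measure lborel (A (j, False))"
        if "j < n" for j
      proof -
        have "AE v in lborel. v \<in> F0 \<longrightarrow> v \<in> A (j, True) \<union> A (j, False)"
          using elim that w(1) by (auto simp: A_def F0_def elim!: eventually_mono)
        then have "emeasure lborel F0 \<le> emeasure lborel (A (j, True) \<union> A (j, False))"
          by (rule emeasure_mono_AE) simp
        moreover have "A (j, True) \<union> A (j, False) \<subseteq> F" by (auto simp: A_def F0_def)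
        then have "emeasure lborel (A (j, True) \<union> A (j, False)) < top"
          using finite_sub[of "A (j, True) \<union> A (j, False)"] by simp
        ultimately have "measure lborel F0 \<le> measure lborel (A (j, True) \<union> A (j, False))"
          unfolding measure_def by (rule enn2real_mono)
        also have "\<dots> \<le> measure lborel (A (j, True)) + measure lborel (A (j, False))"
          by (rule measure_Un_le) auto
        finally show ?thesis .
      qed
      have "real n * measure lborel F0 = (\<Sum>j<n. measure lborel F0)" by simp
      also have "\<dots> \<le> (\<Sum>j<n. \<Sum>b\<in>UNIV. measure lborel (A (j, b)))"
        by (intro sum_mono) (use cover in \<open>simp add: UNIV_bool add.commute\<close>)
      also have "\<dots> = (\<Sum>i\<in>I. measure lborel (A i))"
        by (simp add: I_def sum.cartesian_product)
      also have "\<dots> \<le> (\<Sum>i\<in>I. 4 * measure lborel (B i))" by (intro sum_mono AB)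
      also have "\<dots> = 4 * measure lborel (\<Union>i\<in>I. B i)"
      proof -
        have "measure lborel (\<Union>i\<in>I. B i) = (\<Sum>i\<in>I. measure lborel (B i))"
          using disj Bfin
          by (intro measure_finite_Union) (auto simp: disjoint_family_on_def I_def less_top)
        then show ?thesis by (simp add: sum_distrib_left)
      qed
      also have "\<dots> \<le> 4 * measure lborel F"
        using fin by (intro mult_left_mono measure_mono_fmeasurable) (auto simp: B_def I_def fmeasurable_def)
      finally show False using n by simp
    qed
  qed
  then show ?thesis by blast
qed


text \<open>
  All positions that can be reached from \<open>h\<close> in \<open>k\<close> steps of length \<open>\<bar>h\<bar>\<close>, each orthogonal to the current
  position. Which sign is taken depends on the centre \<open>c\<close>, so both are kept; the sets stay finite.
\<close>

primrec growth :: "real^2 \<Rightarrow> nat \<Rightarrow> (real^2) set" where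
  "growth h 0 = {h}"
| "growth h (Suc k) = (\<Union>x\<in>growth h k. {x + (norm h / norm x) *\<^sub>R rot x, x - (norm h / norm x) *\<^sub>R rot x})"

lemma finite_growth: "finite (growth h k)"
  by (induction k) auto

lemma norm_growth:
  assumes "h \<noteq> 0" "x \<in> growth h k"
  shows "(norm x)\<^sup>2 = real (Suc k) * (norm h)\<^sup>2"
  using assms(2)
proof (induction k arbitrary: x)
  case (Suc k)
  obtain z where z0: "z \<in> growth h k"
    "x = z + (norm h / norm z) *\<^sub>R rot z \<or> x = z - (norm h / norm z) *\<^sub>R rot z"
    using Suc.prems by (simp only: growth.simps UN_iff insert_iff empty_iff) blast
  define \<sigma> :: real where "\<sigma> = (if x = z + (norm h / norm z) *\<^sub>R rot z then 1 else - 1)"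
  have z: "z \<in> growth h k" "\<sigma> = 1 \<or> \<sigma> = - 1"
    "x = 1 *\<^sub>R z + (\<sigma> * (norm h / norm z)) *\<^sub>R rot z"
    using z0 by (auto simp: \<sigma>_def)
  have z2: "(norm z)\<^sup>2 = real (Suc k) * (norm h)\<^sup>2" by (rule Suc.IH[OF z(1)])
  then have "z \<noteq> 0" using assms(1) by auto
  have "norm x = sqrt (1\<^sup>2 + (\<sigma> * (norm h / norm z))\<^sup>2) * norm z"
    unfolding z(3) by (rule norm_rot_comb)
  then have "(norm x)\<^sup>2 = (1 + (norm h / norm z)\<^sup>2) * (norm z)\<^sup>2"
    using z(2) by (auto simp: power_mult_distrib)
  also have "\<dots> = (norm z)\<^sup>2 + (norm h)\<^sup>2"
    using \<open>z \<noteq> 0\<close> by (simp add: power_divide field_simps)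
  finally show ?case by (simp add: z2 algebra_simps)
qed simp

text \<open>
  If the midpoint \<open>c\<close> were missing, \<open>F - c\<close> would meet \<open>growth h k\<close> for every \<open>k\<close>, although
  \<open>F\<close> is bounded. Only countably many rectangles occur, so one null set of centres \<open>c\<close> is excluded.
\<close>

lemma crossing_free_plane_midpoint:
  fixes F :: "(real^2) set"
  assumes F[measurable]: "F \<in> sets borel" and fin: "emeasure lborel F < \<infinity>" and cf: "crossing_free F"
  shows "AE c in lborel. c + h \<in> F \<longrightarrow> c - h \<in> F \<longrightarrow> c \<in> F"
proof (cases "h = 0")
  case False
  obtain R where R: "AE x in lborel. x \<in> F \<longrightarrow> norm x \<le> R"
    using crossing_free_plane_bounded[OF assms] by blast
  define step where "step x = (norm h / norm x) *\<^sub>R rot x" for x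
  define X where "X = (\<Union>k. growth h k)"
  have "countable X" unfolding X_def
    by (intro countable_UN countableI_type countable_finite finite_growth)
  have nz: "x \<noteq> 0" if "x \<in> X" for x
    using that norm_growth[OF False] False unfolding X_def by fastforce
  have norm_step: "norm (step x) = norm h" if "x \<in> X" for x
    using nz[OF that] norm_rot_comb[of 0 x 1] by (simp add: step_def)
  have orth: "norm (x - \<sigma> *\<^sub>R step x) = norm (x + \<sigma> *\<^sub>R step x)" for x \<sigma>
    by (simp add: norm_eq_sqrt_inner step_def inner_add_left inner_add_right inner_diff_left
        inner_diff_right inner_rot)
  have 1: "AE c in lborel. \<forall>x\<in>X. \<not> crossing_at F h (step x) c"
    using \<open>countable X\<close> cf norm_step by (intro AE_ball_countable[THEN iffD2]) (auto simp: crossing_free_def)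
  have 2: "AE c in lborel. \<forall>x\<in>X. \<not> crossing_at F ((x - \<sigma> *\<^sub>R step x) /\<^sub>R 2) ((x + \<sigma> *\<^sub>R step x) /\<^sub>R 2)
      (c + (x + \<sigma> *\<^sub>R step x) /\<^sub>R 2)" for \<sigma>
    using \<open>countable X\<close> cf orth
    by (intro AE_ball_countable[THEN iffD2] ballI AE_lborel_translate) (auto simp: crossing_free_def)
  have 3: "AE c in lborel. \<forall>x\<in>X. c + x \<in> F \<longrightarrow> norm (c + x) \<le> R"
    using \<open>countable X\<close> R
    by (intro AE_ball_countable[THEN iffD2] ballI AE_lborel_translate[where P = "\<lambda>x. x \<in> F \<longrightarrow> norm x \<le> R"]) auto
  have rect: "c \<in> F \<or> c + (x + \<sigma> *\<^sub>R s) \<in> F"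
    if "\<not> crossing_at F ((x - \<sigma> *\<^sub>R s) /\<^sub>R 2) ((x + \<sigma> *\<^sub>R s) /\<^sub>R 2) (c + (x + \<sigma> *\<^sub>R s) /\<^sub>R 2)"
      "c + x \<in> F" "c + \<sigma> *\<^sub>R s \<in> F" for c x s \<sigma>
  proof -
    have eqs: "c + (x + \<sigma> *\<^sub>R s) /\<^sub>R 2 + (x - \<sigma> *\<^sub>R s) /\<^sub>R 2 = c + x"
      "c + (x + \<sigma> *\<^sub>R s) /\<^sub>R 2 - (x - \<sigma> *\<^sub>R s) /\<^sub>R 2 = c + \<sigma> *\<^sub>R s"
      "c + (x + \<sigma> *\<^sub>R s) /\<^sub>R 2 + (x + \<sigma> *\<^sub>R s) /\<^sub>R 2 = c + (x + \<sigma> *\<^sub>R s)"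
      "c + (x + \<sigma> *\<^sub>R s) /\<^sub>R 2 - (x + \<sigma> *\<^sub>R s) /\<^sub>R 2 = c"
      by (simp_all add: vec_eq_iff forall_2 field_simps)
    show ?thesis using that unfolding crossing_at_def eqs by blast
  qed
  from 1 2[of 1] 2[of "- 1"] 3 show ?thesis
  proof eventually_elim
    case (elim c)
    show ?case
    proof (intro impI, rule ccontr)
      assume c: "c + h \<in> F" "c - h \<in> F" "c \<notin> F"
      have ex: "\<exists>x\<in>growth h k. c + x \<in> F" for k
      proof (induction k)
        case (Suc k)
        then obtain x where x: "x \<in> growth h k" "c + x \<in> F" by blast
        have xX: "x \<in> X" using x(1) by (auto simp: X_def)
        have "\<not> crossing_at F h (step x) c" using elim(1) xX by blast
        then consider "c + 1 *\<^sub>R step x \<in> F" | "c + (- 1) *\<^sub>R step x \<in> F"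
          using c by (auto simp: crossing_at_def)
        then show ?case
        proof cases
          case 1
          then have "c + (x + 1 *\<^sub>R step x) \<in> F" using rect[OF _ x(2) 1] elim(2) xX c(3) by blast
          then show ?thesis using x(1) by (auto simp: step_def)
        next
          case 2
          then have "c + (x + (- 1) *\<^sub>R step x) \<in> F" using rect[OF _ x(2) 2] elim(3) xX c(3) by blast
          then show ?thesis using x(1) by (auto simp: step_def)
        qed
      qed (use c in simp)
      obtain k :: nat where k: "((R + norm c) / norm h)\<^sup>2 < real k" using reals_Archimedean2 by blast
      obtain x where x: "x \<in> growth h k" "c + x \<in> F" using ex by blast
      have "norm (c + x) \<le> R" using elim(4) x by (auto simp: X_def)
      then have "norm x \<le> R + norm c" using norm_triangle_ineq4[of "c + x" c] by simp
      then have "(norm x)\<^sup>2 \<le> (R + norm c)\<^sup>2" by (intro power_mono) auto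
      also have "\<dots> < real k * (norm h)\<^sup>2" using k False by (simp add: power_divide field_simps)
      also have "\<dots> \<le> (norm x)\<^sup>2" using norm_growth[OF False x(1)] by (simp add: algebra_simps)
      finally show False by simp
    qed
  qed
qed simp

section \<open>Midpoint convexity in higher dimensions\<close>

text \<open>
  For a linear isometry \<open>L\<close> from the plane whose image contains \<open>h\<close>, almost every slice
  \<open>F x = {z. x + L z \<in> S}\<close> is a plane set without crossings and of finite measure. Letting the
  base point \<open>x\<close> range over the whole space, with redundancy, reduces every use of Fubini to a translation by \<open>L z\<close>.
\<close>

lemma crossing_free_midpoint:
  fixes S :: "'a::euclidean_space set"
  assumes dim: "DIM('a) \<ge> 2"
    and S[measurable]: "S \<in> sets borel" and fin: "emeasure lborel S < \<infinity>" and cf: "crossing_free S"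
  shows "AE c in lborel. c + h \<in> S \<longrightarrow> c - h \<in> S \<longrightarrow> c \<in> S"
proof (cases "h = 0")
  case False
  define e1 where "e1 = h /\<^sub>R norm h"
  obtain f where f: "f \<noteq> 0" "orthogonal h f" using orthogonal_to_vector_exists[OF dim] by blast
  define e2 where "e2 = f /\<^sub>R norm f"
  have e: "e1 \<bullet> e1 = 1" "e2 \<bullet> e2 = 1" "e1 \<bullet> e2 = 0" "e2 \<bullet> e1 = 0"
    using False f by (auto simp: e1_def e2_def orthogonal_def dot_square_norm power2_eq_square inner_commute)
  define L where "L z = (z $ 1) *\<^sub>R e1 + (z $ 2) *\<^sub>R e2" for z :: "real^2"
  have L_lin: "L (y + z) = L y + L z" "L (y - z) = L y - L z" "L (- z) = - L z" "L (c *\<^sub>R z) = c *\<^sub>R L z" for y z c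
    by (simp_all add: L_def algebra_simps)
  have norm_L: "norm (L z) = norm z" for z
  proof -
    have "L z \<bullet> L z = z \<bullet> z"
      by (simp add: L_def inner_add_left inner_add_right e inner_vec_def sum_2)
    then show ?thesis by (simp add: norm_eq_sqrt_inner)
  qed
  have [measurable]: "L \<in> borel_measurable borel"
    unfolding L_def by (intro borel_measurable_continuous_onI continuous_intros)
  define F where "F x = {z. x + L z \<in> S}" for x
  have F_meas[measurable]: "F x \<in> sets borel" for x
  proof -
    have "F x = (\<lambda>z. x + L z) -` S" by (auto simp: F_def)
    then show ?thesis by (simp add: measurable_sets_borel[OF _ S])
  qed
  have "AE x in lborel. x \<in> ball 0 (real k) \<longrightarrow> emeasure lborel (F x) < \<infinity>" for k
  proof -
    have P: "pair_sigma_finite (lborel :: 'a measure) (lborel :: (real^2) measure)" ..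
    \<comment> \<open>The sets \<open>Q\<close> and \<open>Q'\<close> correspond under the shear \<open>y = x + L z\<close>; in \<open>Q'\<close> the slices over \<open>y\<close> lie in discs of radius \<open>2 k\<close>.\<close>
    define Q where "Q = {p :: 'a \<times> (real^2). norm (fst p) < real k \<and> fst p + L (snd p) \<in> S}"
    define Q' where "Q' = {p :: 'a \<times> (real^2). norm (fst p - L (snd p)) < real k \<and> fst p \<in> S}"
    have "Measurable.pred (borel \<Otimes>\<^sub>M borel) (\<lambda>p :: 'a \<times> (real^2). norm (fst p) < real k \<and> fst p + L (snd p) \<in> S)"
      by measurable
    then have Q[measurable]: "Q \<in> sets (lborel \<Otimes>\<^sub>M lborel)"
      by (simp add: pred_def Q_def space_pair_measure)
    have "Measurable.pred (borel \<Otimes>\<^sub>M borel) (\<lambda>p :: 'a \<times> (real^2). norm (fst p - L (snd p)) < real k \<and> fst p \<in> S)"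
      by measurable
    then have Q'[measurable]: "Q' \<in> sets (lborel \<Otimes>\<^sub>M lborel)"
      by (simp add: pred_def Q'_def space_pair_measure)
    have "emeasure lborel ((\<lambda>x. (x, z)) -` Q) = emeasure lborel ((\<lambda>x. (x, z)) -` Q')" for z
    proof -
      have "(\<lambda>x. (x, z)) -` Q' \<in> sets borel" using sets_Pair2[OF Q', of z] by simp
      from emeasure_lborel_translate[OF this, of "L z"] show ?thesis
        by (simp add: Q_def Q'_def)
    qed
    then have QQ': "emeasure (lborel \<Otimes>\<^sub>M lborel) Q = emeasure (lborel \<Otimes>\<^sub>M lborel) Q'"
      by (simp add: pair_sigma_finite.emeasure_pair_measure_alt2[OF P Q] pair_sigma_finite.emeasure_pair_measure_alt2[OF P Q'])
    define C where "C = emeasure lborel (ball (0::real^2) (2 * real k))"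
    have C: "C < \<infinity>" unfolding C_def by (rule emeasure_bounded_finite) simp
    have slice: "emeasure lborel (Pair y -` Q') \<le> C * indicator S y" for y
    proof (cases "Pair y -` Q' = {}")
      case False
      then obtain z0 where z0: "norm (y - L z0) < real k" "y \<in> S" by (auto simp: Q'_def dist_norm)
      have "Pair y -` Q' \<subseteq> {z. z + (- z0) \<in> ball 0 (2 * real k)}"
      proof (intro subsetI CollectI)
        fix z assume "z \<in> Pair y -` Q'"
        then have "norm (y - L z) < real k" by (simp add: Q'_def)
        then have "norm ((y - L z0) - (y - L z)) < real k + real k"
          using z0(1) norm_triangle_ineq4[of "y - L z0" "y - L z"] by linarith
        then have "norm (L (z - z0)) < 2 * real k" by (simp add: L_lin)
        then show "z + (- z0) \<in> ball 0 (2 * real k)" by (simp add: norm_L)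
      qed
      then have "emeasure lborel (Pair y -` Q') \<le> emeasure lborel {z. z + (- z0) \<in> ball 0 (2 * real k)}"
        by (rule emeasure_mono) simp
      also have "\<dots> = C" unfolding C_def by (rule emeasure_lborel_translate) simp
      finally show ?thesis using z0(2) by simp
    qed simp
    have "emeasure (lborel \<Otimes>\<^sub>M lborel) Q' = (\<integral>\<^sup>+y. emeasure lborel (Pair y -` Q') \<partial>lborel)"
      by (rule lborel.emeasure_pair_measure_alt[OF Q'])
    also have "\<dots> \<le> (\<integral>\<^sup>+y. C * indicator S y \<partial>lborel)" by (intro nn_integral_mono slice)
    also have "\<dots> = C * emeasure lborel S" by (simp add: nn_integral_cmult_indicator)
    also have "\<dots> < \<infinity>" using C fin by (simp add: ennreal_mult_less_top)
    finally have "(\<integral>\<^sup>+x. emeasure lborel (Pair x -` Q) \<partial>lborel) \<noteq> \<infinity>"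
      by (simp add: QQ'[symmetric] lborel.emeasure_pair_measure_alt[OF Q])
    then have "AE x in lborel. emeasure lborel (Pair x -` Q) \<noteq> \<infinity>"
      by (intro nn_integral_noteq_infinite) (simp_all add: lborel.measurable_emeasure_Pair[OF Q, simplified])
    then show ?thesis
    proof eventually_elim
      case (elim x)
      then show ?case by (auto simp: Q_def F_def less_top)
    qed
  qed
  then have "AE x in lborel. \<forall>k. x \<in> ball 0 (real k) \<longrightarrow> emeasure lborel (F x) < \<infinity>"
    by (subst AE_all_countable) blast
  then have F_fin: "AE x in lborel. emeasure lborel (F x) < \<infinity>"
  proof eventually_elim
    case (elim x)
    then show ?case using reals_Archimedean2[of "norm x"] by auto
  qed
  \<comment> \<open>A countable dense set of shapes suffices for all shapes, by \<open>crossing_at_AE_limit\<close>.\<close>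
  define W where "W = {p :: (real^2) \<times> (real^2). norm (fst p) = norm (snd p)}"
  obtain T where T: "countable T" "T \<subseteq> W" "W \<subseteq> closure T" using separable by blast
  have "AE x in lborel. AE z in lborel. \<not> crossing_at (F x) (fst p) (snd p) z" if "p \<in> T" for p
  proof -
    have "norm (L (fst p)) = norm (L (snd p))" using that T(2) by (auto simp: norm_L W_def)
    then have "AE x in lborel. \<not> crossing_at S (L (fst p)) (L (snd p)) (x + L z)" for z
      using cf by (intro AE_lborel_translate) (auto simp: crossing_free_def)
    then have "AE z in lborel. AE x in lborel. \<not> crossing_at S (L (fst p)) (L (snd p)) (x + L z)"
      by simp
    then have "AE x in lborel. AE z in lborel. \<not> crossing_at S (L (fst p)) (L (snd p)) (x + L z)"
      by (rule AE_lborel_swap[rotated]) measurable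
    then show ?thesis by (simp add: crossing_at_def F_def L_lin algebra_simps)
  qed
  then have "AE x in lborel. \<forall>p\<in>T. AE z in lborel. \<not> crossing_at (F x) (fst p) (snd p) z"
    using T(1) by (simp add: AE_ball_countable)
  then have "AE x in lborel. crossing_free (F x)"
    using F_fin
  proof eventually_elim
    case (elim x)
    show ?case unfolding crossing_free_def
    proof (intro allI impI)
      fix a b :: "real^2" assume "norm a = norm b"
      then have ab: "(a, b) \<in> closure T" using T(3) by (auto simp: W_def)
      show "AE c in lborel. \<not> crossing_at (F x) a b c"
      proof (rule crossing_at_AE_limit[OF F_meas elim(2)])
        fix e :: real assume "e > 0"
        then obtain p where p: "p \<in> T" "dist p (a, b) < e" using ab by (auto simp: closure_approachable)
        have "norm (fst p - a) < e" "norm (snd p - b) < e"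
          using dist_fst_le[of p "(a, b)"] dist_snd_le[of p "(a, b)"] p(2) by (auto simp: dist_norm)
        then show "\<exists>a' b'. norm (a' - a) < e \<and> norm (b' - b) < e \<and> (AE c in lborel. \<not> crossing_at (F x) a' b' c)"
          using elim(1) p(1) by blast
      qed
    qed
  qed
  define h' where "h' = (\<chi> i. if i = 1 then norm h else 0 :: real^2)"
  have "L h' = h" using False by (simp add: L_def h'_def e1_def)
  have "AE x in lborel. AE z in lborel. z + h' \<in> F x \<longrightarrow> z - h' \<in> F x \<longrightarrow> z \<in> F x"
    using \<open>AE x in lborel. crossing_free (F x)\<close> F_fin
    by eventually_elim (rule crossing_free_plane_midpoint[OF F_meas])
  then have "AE x in lborel. AE z in lborel. (x + L z) + h \<in> S \<longrightarrow> (x + L z) - h \<in> S \<longrightarrow> x + L z \<in> S"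
    by (simp add: F_def L_lin \<open>L h' = h\<close> algebra_simps)
  then have "AE z in lborel. AE x in lborel. (x + L z) + h \<in> S \<longrightarrow> (x + L z) - h \<in> S \<longrightarrow> x + L z \<in> S"
    by (rule AE_lborel_swap[rotated]) measurable
  then obtain z where z: "AE x in lborel. (x + L z) + h \<in> S \<longrightarrow> (x + L z) - h \<in> S \<longrightarrow> x + L z \<in> S"
    using AE_lborel_ex[OF _ open_UNIV] by blast
  from AE_lborel_translate[OF z, of "- L z"] show ?thesis by simp
qed simp

section \<open>From midpoint convexity almost everywhere to convexity\<close>

text \<open>
  Dyadic combinations stay in \<open>S\<close>; since both ends may be shifted by a common small vector, the remaining
  ratios are reached by shifting a dyadic point.
\<close>

lemma open_midpoint_convex_imp_convex:
  fixes S :: "'a::real_normed_vector set"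
  assumes "open S" and mid: "\<And>x y. x \<in> S \<Longrightarrow> y \<in> S \<Longrightarrow> (x + y) /\<^sub>R 2 \<in> S"
  shows "convex S"
proof (rule convexI)
  have average: "((x + \<alpha> *\<^sub>R d) + (x + \<beta> *\<^sub>R d)) /\<^sub>R 2 = x + ((\<alpha> + \<beta>) / 2) *\<^sub>R d"
    for x d :: 'a and \<alpha> \<beta> :: real
  proof -
    have "(x + \<alpha> *\<^sub>R d) + (x + \<beta> *\<^sub>R d) = 2 *\<^sub>R (x + ((\<alpha> + \<beta>) / 2) *\<^sub>R d)"
      by (simp add: scaleR_add_right scaleR_add_left scaleR_2 add_divide_distrib)
    then show ?thesis by simp
  qed
  have dyadic: "x + (real m / 2 ^ n) *\<^sub>R (y - x) \<in> S" if "x \<in> S" "y \<in> S" "m \<le> 2 ^ n" for x y m n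
    using that(3)
  proof (induction n arbitrary: m)
    case 0
    then have "m = 0 \<or> m = 1" by auto
    then show ?case using that by auto
  next
    case (Suc n)
    show ?case
    proof (cases "even m")
      case True
      then obtain k where "m = 2 * k" by blast
      then show ?thesis using Suc.IH[of k] Suc.prems by simp
    next
      case False
      then obtain k where k: "m = 2 * k + 1" by (rule oddE)
      then have "k \<le> 2 ^ n" "Suc k \<le> 2 ^ n" using Suc.prems by auto
      then have "((x + (real k / 2 ^ n) *\<^sub>R (y - x)) + (x + (real (Suc k) / 2 ^ n) *\<^sub>R (y - x))) /\<^sub>R 2 \<in> S"
        by (intro mid Suc.IH)
      also have "((x + (real k / 2 ^ n) *\<^sub>R (y - x)) + (x + (real (Suc k) / 2 ^ n) *\<^sub>R (y - x))) /\<^sub>R 2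
          = x + ((real k / 2 ^ n + real (Suc k) / 2 ^ n) / 2) *\<^sub>R (y - x)"
        by (rule average)
      also have "(real k / 2 ^ n + real (Suc k) / 2 ^ n) / 2 = real m / 2 ^ Suc n"
        by (simp add: k add_divide_distrib)
      finally show ?thesis by simp
    qed
  qed
  fix x y :: 'a and u v :: real
  assume xy: "x \<in> S" "y \<in> S" and uv: "u \<ge> 0" "v \<ge> 0" "u + v = 1"
  obtain e1 where e1: "e1 > 0" "ball x e1 \<subseteq> S" using assms(1) xy(1) by (meson openE)
  obtain e2 where e2: "e2 > 0" "ball y e2 \<subseteq> S" using assms(1) xy(2) by (meson openE)
  define e where "e = min e1 e2"
  have "e > 0" using e1 e2 by (simp add: e_def)
  obtain n where n: "norm (y - x) / e < 2 ^ n" using real_arch_pow[of 2 "norm (y - x) / e"] by auto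
  define m where "m = nat \<lfloor>v * 2 ^ n\<rfloor>"
  have fl: "real m = of_int \<lfloor>v * 2 ^ n\<rfloor>" using uv by (simp add: m_def)
  have m: "real m \<le> v * 2 ^ n" "v * 2 ^ n < real m + 1" unfolding fl by linarith+
  have "v \<le> 1" using uv by simp
  then have "v * 2 ^ n \<le> 1 * 2 ^ n" by (intro mult_right_mono) auto
  with m(1) have "real m \<le> 1 * 2 ^ n" by (rule order_trans)
  then have "real m \<le> real (2 ^ n)" by (simp only: of_nat_power of_nat_numeral mult_1)
  then have m2: "m \<le> 2 ^ n" by (simp only: of_nat_le_iff)
  define z where "z = (v - real m / 2 ^ n) *\<^sub>R (y - x)"
  have "v - real m / 2 ^ n = (v * 2 ^ n - real m) / 2 ^ n" by (simp add: diff_divide_distrib)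
  then have "\<bar>v - real m / 2 ^ n\<bar> \<le> 1 / 2 ^ n" using m by (simp add: abs_divide divide_right_mono)
  then have "norm z \<le> 1 / 2 ^ n * norm (y - x)" unfolding z_def norm_scaleR by (intro mult_right_mono) auto
  also have "\<dots> < e" using n \<open>e > 0\<close> by (simp add: field_simps)
  finally have "x + z \<in> S" "y + z \<in> S" using e1 e2 by (auto simp: e_def subset_eq dist_norm)
  then have "(x + z) + (real m / 2 ^ n) *\<^sub>R ((y + z) - (x + z)) \<in> S" using m2 by (rule dyadic)
  also have "(x + z) + (real m / 2 ^ n) *\<^sub>R ((y + z) - (x + z)) = x + v *\<^sub>R (y - x)"
    by (simp add: z_def scaleR_diff_left)
  also have "\<dots> = (1 - v) *\<^sub>R x + v *\<^sub>R y" by (simp add: algebra_simps)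
  also have "1 - v = u" using uv by simp
  finally show "u *\<^sub>R x + v *\<^sub>R y \<in> S" .
qed

text \<open>
  Let \<open>\<Phi> x\<close> be the set of \<open>y\<close> for which \<open>x + y\<close> and \<open>x - y\<close> both lie in \<open>S\<close>. Its measure depends
  continuously on \<open>x\<close>, so the set \<open>U\<close> of centres where it is positive is open. By hypothesis almost
  every point of \<open>U\<close> lies in \<open>S\<close>. Conversely \<open>S - U\<close> is a null set: a set of positive measure meets
  its translates by \<open>y\<close> and \<open>- y\<close> in a common set of positive measure for all small \<open>y\<close>, whereas
  \<open>\<Phi> x\<close> is a null set for \<open>x\<close> in \<open>S - U\<close>.
\<close>

lemma AE_midpoint_convex_imp_open_convex:
  fixes S :: "'a::euclidean_space set"
  assumes S[measurable]: "S \<in> sets borel" and fin: "emeasure lborel S < \<infinity>"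
    and mid: "\<And>h. AE c in lborel. c + h \<in> S \<longrightarrow> c - h \<in> S \<longrightarrow> c \<in> S"
  shows "\<exists>U. open U \<and> convex U \<and> (AE x in lborel. x \<in> S \<longleftrightarrow> x \<in> U)"
proof -
  define \<Phi> where "\<Phi> x = {y. x + y \<in> S \<and> x - y \<in> S}" for x
  define U where "U = {x. emeasure lborel (\<Phi> x) \<noteq> 0}"
  have \<Phi>_meas[measurable]: "\<Phi> x \<in> sets borel" for x unfolding \<Phi>_def by measurable
  have "open U"
  proof (rule openI)
    fix x0 assume "x0 \<in> U"
    have "emeasure lborel (\<Phi> x0) \<le> emeasure lborel {y. y + x0 \<in> S}"
      by (intro emeasure_mono) (auto simp: \<Phi>_def add.commute)
    also have "\<dots> = emeasure lborel S" by (rule emeasure_lborel_translate[OF S])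
    finally have m_fin: "emeasure lborel (\<Phi> x0) < \<infinity>" using fin by simp
    define m where "m = measure lborel (\<Phi> x0)"
    have m: "emeasure lborel (\<Phi> x0) = ennreal m"
      unfolding m_def using m_fin by (intro emeasure_eq_ennreal_measure) auto
    have "m > 0" using m \<open>x0 \<in> U\<close> measure_nonneg[of lborel "\<Phi> x0"] by (auto simp: U_def m_def less_le)
    obtain d where d: "d > 0" "\<And>h. norm h < d \<Longrightarrow> emeasure lborel {x \<in> S. x + h \<notin> S} < ennreal (m/2)"
      using translation_continuity[OF S fin, of "m/2"] \<open>m > 0\<close> by auto
    have "x \<in> U" if x: "dist x0 x < d" for x
    proof (rule ccontr)
      assume "x \<notin> U"
      define h where "h = x - x0"
      let ?D = "{x \<in> S. x + h \<notin> S}"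
      have h: "emeasure lborel ?D < ennreal (m/2)"
        using x by (intro d(2)) (simp add: h_def dist_norm norm_minus_commute)
      have "emeasure lborel (\<Phi> x0) \<le> emeasure lborel (\<Phi> x \<union> ({y. y + x0 \<in> ?D} \<union> {y. x0 - y \<in> ?D}))"
        by (intro emeasure_mono) (auto simp: \<Phi>_def h_def algebra_simps)
      also have "\<dots> \<le> emeasure lborel (\<Phi> x) + (emeasure lborel {y. y + x0 \<in> ?D} + emeasure lborel {y. x0 - y \<in> ?D})"
        by (rule order_trans[OF emeasure_subadditive], simp, simp, intro add_mono order_refl emeasure_subadditive) auto
      also have "\<dots> = emeasure lborel ?D + emeasure lborel ?D"
        using \<open>x \<notin> U\<close> by (subst emeasure_lborel_translate, simp, subst emeasure_lborel_reflect) (auto simp: U_def)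
      also have "\<dots> < ennreal (m/2) + ennreal (m/2)" using h by (intro add_strict_mono)
      also have "\<dots> = emeasure lborel (\<Phi> x0)" unfolding m using \<open>m > 0\<close> by (simp flip: ennreal_plus)
      finally show False by simp
    qed
    then show "\<exists>e>0. ball x0 e \<subseteq> U" using d(1) by (intro exI[of _ d]) auto
  qed
  have [measurable]: "U \<in> sets borel" using \<open>open U\<close> by simp
  have U_S: "AE x in lborel. x \<in> U \<longrightarrow> x \<in> S"
  proof -
    have "AE y in lborel. AE x in lborel. x + y \<in> S \<longrightarrow> x - y \<in> S \<longrightarrow> x \<in> S" using mid by simp
    then have "AE x in lborel. AE y in lborel. x + y \<in> S \<longrightarrow> x - y \<in> S \<longrightarrow> x \<in> S"
      by (rule AE_lborel_swap[rotated]) measurable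
    then show ?thesis
    proof eventually_elim
      case (elim x)
      show ?case
      proof (intro impI, rule ccontr)
        assume "x \<in> U" "x \<notin> S"
        then have "AE y in lborel. y \<notin> \<Phi> x" using elim by (auto simp: \<Phi>_def)
        then have "\<Phi> x \<in> null_sets lborel" by (subst AE_iff_null_sets) auto
        then show False using \<open>x \<in> U\<close> by (auto simp: U_def)
      qed
    qed
  qed
  have S_U: "AE x in lborel. x \<in> S \<longrightarrow> x \<in> U"
  proof (rule ccontr)
    define Z where "Z = S - U"
    assume "\<not> ?thesis"
    then have "\<not> (AE x in lborel. x \<notin> Z)" by (simp add: Z_def)
    have [measurable]: "Z \<in> sets borel" by (simp add: Z_def)
    have Zfin: "emeasure lborel Z < \<infinity>"
      using emeasure_mono[of Z S lborel] fin by (auto simp: Z_def)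
    define m where "m = measure lborel Z"
    have m: "emeasure lborel Z = ennreal m"
      unfolding m_def using Zfin by (intro emeasure_eq_ennreal_measure) auto
    have "emeasure lborel Z \<noteq> 0"
      using \<open>\<not> (AE x in lborel. x \<notin> Z)\<close> AE_iff_null_sets[of Z lborel] by (auto simp: null_sets_def)
    then have "m > 0" using m measure_nonneg[of lborel Z] by (auto simp: m_def less_le)
    obtain d where d: "d > 0" "\<And>h. norm h < d \<Longrightarrow> emeasure lborel {x \<in> Z. x + h \<notin> Z} < ennreal (m/2)"
      using translation_continuity[of Z, OF _ Zfin, of "m/2"] \<open>m > 0\<close> by auto
    have "AE y in lborel. \<not> (x \<in> Z \<and> x + y \<in> Z \<and> x - y \<in> Z)" for x
    proof (cases "x \<in> Z")
      case True
      then have "\<Phi> x \<in> null_sets lborel" by (simp add: Z_def U_def null_sets_def)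
      then have "AE y in lborel. y \<notin> \<Phi> x" by (rule AE_not_in)
      then show ?thesis by (rule eventually_mono) (auto simp: \<Phi>_def Z_def)
    qed simp
    then have "AE x in lborel. AE y in lborel. \<not> (x \<in> Z \<and> x + y \<in> Z \<and> x - y \<in> Z)" by simp
    then have "AE y in lborel. AE x in lborel. \<not> (x \<in> Z \<and> x + y \<in> Z \<and> x - y \<in> Z)"
      by (rule AE_lborel_swap[rotated]) measurable
    then obtain y where y: "norm y < d" "AE x in lborel. \<not> (x \<in> Z \<and> x + y \<in> Z \<and> x - y \<in> Z)"
      using AE_lborel_ex[of _ "ball 0 d"] d(1) by fastforce
    have "emeasure lborel Z \<le> emeasure lborel ({x \<in> Z. x + y \<notin> Z} \<union> {x \<in> Z. x + (- y) \<notin> Z})"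
      using y(2) by (intro emeasure_mono_AE) (auto elim!: eventually_mono)
    also have "\<dots> \<le> emeasure lborel {x \<in> Z. x + y \<notin> Z} + emeasure lborel {x \<in> Z. x + (- y) \<notin> Z}"
      by (rule emeasure_subadditive) auto
    also have "\<dots> < ennreal (m/2) + ennreal (m/2)" using y(1) by (intro add_strict_mono d(2)) auto
    also have "\<dots> = emeasure lborel Z" unfolding m using \<open>m > 0\<close> by (simp flip: ennreal_plus)
    finally show False by simp
  qed
  have full: "c \<in> U" if "e > 0" and ae: "AE x in lborel. x \<in> ball c e \<longrightarrow> x \<in> S" for c e
  proof -
    have "AE y in lborel. y + c \<in> ball c e \<longrightarrow> y + c \<in> S"
      by (rule AE_lborel_translate[OF ae])
    moreover have "AE y in lborel. c + (- 1) *\<^sub>R y \<in> ball c e \<longrightarrow> c + (- 1) *\<^sub>R y \<in> S"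
      by (rule AE_lborel_affine[OF _ ae]) simp
    ultimately have "AE y in lborel. y \<in> ball 0 e \<longrightarrow> y \<in> \<Phi> c"
      by eventually_elim (auto simp: \<Phi>_def dist_norm add.commute)
    then have "emeasure lborel (ball 0 e :: 'a set) \<le> emeasure lborel (\<Phi> c)"
      by (rule emeasure_mono_AE) simp
    moreover have "emeasure lborel (ball 0 e :: 'a set) \<noteq> 0"
      using open_not_negligible[of "ball (0::'a) e"] \<open>e > 0\<close>
      by (auto simp: negligible_iff_null_sets null_sets_def)
    ultimately show ?thesis by (auto simp: U_def)
  qed
  have "convex U"
  proof (rule open_midpoint_convex_imp_convex[OF \<open>open U\<close>])
    fix x y assume xy: "x \<in> U" "y \<in> U"
    obtain e1 where e1: "e1 > 0" "ball x e1 \<subseteq> U" using \<open>open U\<close> xy(1) by (meson openE)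
    obtain e2 where e2: "e2 > 0" "ball y e2 \<subseteq> U" using \<open>open U\<close> xy(2) by (meson openE)
    define h where "h = (x - y) /\<^sub>R 2"
    define c where "c = (x + y) /\<^sub>R 2"
    have ch: "x = c + h" "y = c - h"
      by (simp_all add: c_def h_def algebra_simps flip: scaleR_add_left)
    have "AE z in lborel. z + h \<in> U \<longrightarrow> z + h \<in> S" "AE z in lborel. z + (- h) \<in> U \<longrightarrow> z + (- h) \<in> S"
      using AE_lborel_translate[OF U_S] by blast+
    with mid[of h] have "AE z in lborel. z \<in> ball c (min e1 e2) \<longrightarrow> z \<in> S"
    proof eventually_elim
      case (elim z)
      have "z + h \<in> U \<and> z - h \<in> U" if "z \<in> ball c (min e1 e2)"
      proof -
        have "dist x (z + h) = dist c z" "dist y (z - h) = dist c z" by (simp_all add: ch dist_norm)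
        then show ?thesis using that e1(2) e2(2) by auto
      qed
      then show ?case using elim by auto
    qed
    then show "(x + y) /\<^sub>R 2 \<in> U" unfolding c_def[symmetric] by (rule full[rotated]) (use e1 e2 in auto)
  qed
  then show ?thesis using \<open>open U\<close> U_S S_U by (intro exI[of _ U]) auto
qed

text \<open>
  A convex set containing a ball of radius \<open>r\<close> and a far point \<open>y\<close> contains balls of radius \<open>r / 2\<close> about all points
  of the first half of the segment towards \<open>y\<close>, and many of these are disjoint.
\<close>

lemma open_convex_finite_measure_bounded:
  fixes U :: "'a::euclidean_space set"
  assumes "open U" "convex U" and fin: "emeasure lborel U < \<infinity>"
  shows "bounded U"
proof (rule ccontr)
  assume unb: "\<not> bounded U"
  then obtain x0 where "x0 \<in> U" by fastforce
  then obtain r where r: "r > 0" "ball x0 r \<subseteq> U" using assms(1) by (meson openE)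
  have UL: "U \<in> fmeasurable lborel" using assms by (auto intro: fmeasurableI)
  define \<beta> where "\<beta> = measure lborel (ball (0::'a) (r/2))"
  have \<beta>: "\<beta> > 0" unfolding \<beta>_def using r(1) by (simp add: content_ball_pos)
  have \<beta>_eq: "measure lborel (ball c (r/2)) = \<beta>" for c :: 'a
    using emeasure_lborel_translate[of "ball (0::'a) (r/2)" "- c"]
    by (simp add: \<beta>_def measure_def ball_def dist_norm norm_minus_commute)
  obtain N :: nat where N: "real N * \<beta> > measure lborel U" using ex_less_of_nat_mult[OF \<beta>] by auto
  have "N > 0" using N measure_nonneg[of lborel U] by (cases N) auto
  obtain y where y: "y \<in> U" "norm (y - x0) > 2 * real N * r"
  proof -
    have "\<not> U \<subseteq> cball x0 (2 * real N * r)" using unb bounded_subset bounded_cball by blast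
    then show ?thesis using that by (auto simp: subset_eq dist_norm norm_minus_commute)
  qed
  define t where "t j = real j / (2 * real N)" for j
  define c where "c j = x0 + t j *\<^sub>R (y - x0)" for j
  have t: "0 \<le> t j" "t j \<le> 1/2" if "j < N" for j using that \<open>N > 0\<close> by (auto simp: t_def field_simps)
  have sub: "ball (c j) (r/2) \<subseteq> U" if j: "j < N" for j
  proof
    fix z assume z: "z \<in> ball (c j) (r/2)"
    define s where "s = 1 - t j"
    have s: "s \<ge> 1/2" "s \<le> 1" using t[OF j] by (simp_all add: s_def)
    define x where "x = x0 + (1 / s) *\<^sub>R (z - c j)"
    have "norm (z - c j) < r / 2" using z by (simp add: dist_norm norm_minus_commute)
    also have "\<dots> \<le> r * s" using s r(1) by simp
    finally have "norm (z - c j) / s < r" using s by (simp add: pos_divide_less_eq)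
    then have "x \<in> U" using r(2) s by (auto simp: x_def subset_eq dist_norm)
    then have "s *\<^sub>R x + t j *\<^sub>R y \<in> U"
      using assms(2) y(1) s t(1)[OF j] by (intro convexD) (auto simp: s_def)
    moreover have "s *\<^sub>R x = s *\<^sub>R x0 + (z - c j)" using s by (simp add: x_def scaleR_add_right)
    then have "s *\<^sub>R x + t j *\<^sub>R y = z" by (simp add: c_def s_def algebra_simps)
    ultimately show "z \<in> U" by simp
  qed
  have disj: "disjoint_family_on (\<lambda>j. ball (c j) (r/2)) {..<N}"
  proof (unfold disjoint_family_on_def, intro ballI impI)
    fix i j assume "i \<in> {..<N}" "j \<in> {..<N}" "i \<noteq> j"
    then have "1 \<le> \<bar>real i - real j\<bar>" by linarith
    then have "1 / (2 * real N) \<le> \<bar>t i - t j\<bar>"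
      by (simp add: t_def divide_right_mono flip: diff_divide_distrib)
    have "r = 1 / (2 * real N) * (2 * real N * r)" using \<open>N > 0\<close> by simp
    also have "\<dots> \<le> \<bar>t i - t j\<bar> * norm (y - x0)"
      using \<open>1 / (2 * real N) \<le> \<bar>t i - t j\<bar>\<close> y(2) r(1) by (intro mult_mono) auto
    also have "\<dots> = dist (c i) (c j)" by (simp add: c_def dist_norm flip: scaleR_diff_left)
    finally show "ball (c i) (r/2) \<inter> ball (c j) (r/2) = {}" by (intro disjoint_ballI) simp
  qed
  have ball_fin: "emeasure lborel (ball z s) \<noteq> top" for z :: 'a and s
    using emeasure_bounded_finite[OF bounded_ball, of z s] by (simp add: less_top)
  have "real N * \<beta> = (\<Sum>j<N. measure lborel (ball (c j) (r/2)))" by (simp add: \<beta>_eq)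
  also have "\<dots> = measure lborel (\<Union>j\<in>{..<N}. ball (c j) (r/2))"
    using disj by (intro measure_finite_Union[symmetric]) (use ball_fin in auto)
  also have "\<dots> \<le> measure lborel U"
    using sub UL by (intro measure_mono_fmeasurable) auto
  finally show False using N by simp
qed

section \<open>Compact sets closed under exchange of diagonals\<close>

text \<open>
  The segments from \<open>v\<close> to \<open>w\<close> and from \<open>p\<close> to \<open>q\<close> are the diagonals of a rectangle exactly when they have
  the same midpoint and the same length.
\<close>

definition diagonal_closed :: "'a::real_normed_vector set \<Rightarrow> bool" where
  "diagonal_closed A \<longleftrightarrow>
     (\<forall>v\<in>A. \<forall>w\<in>A. \<forall>p q. p + q = v + w \<longrightarrow> norm (p - q) = norm (v - w) \<longrightarrow> p \<in> A \<or> q \<in> A)"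

lemma norm_reflect:
  fixes d e :: "'a::real_inner"
  assumes "norm e = 1"
  shows "norm (d - (2 * (d \<bullet> e)) *\<^sub>R e) = norm d"
proof -
  have "e \<bullet> e = 1" using assms by (simp add: dot_square_norm)
  then have "(d - (2 * (d \<bullet> e)) *\<^sub>R e) \<bullet> (d - (2 * (d \<bullet> e)) *\<^sub>R e) = d \<bullet> d"
    by (simp add: inner_diff_left inner_diff_right algebra_simps inner_commute)
  then show ?thesis by (simp add: norm_eq_sqrt_inner)
qed

text \<open>
  A highest point \<open>x\<close> and a lowest point \<open>y\<close> in direction \<open>e\<close> span a diagonal of a rectangle with one side parallel to \<open>e\<close>.
  One end of the other diagonal lies in \<open>A\<close>, and it is at the same height as \<open>x\<close> or as \<open>y\<close>.
\<close>

lemma full_width_chord: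
  fixes A :: "'a::euclidean_space set"
  assumes A: "compact A" "A \<noteq> {}" "diagonal_closed A" and e: "norm e = 1"
  obtains x y where "x \<in> A" "y \<in> A" "x - y = ((x - y) \<bullet> e) *\<^sub>R e"
    "\<And>z. z \<in> A \<Longrightarrow> y \<bullet> e \<le> z \<bullet> e \<and> z \<bullet> e \<le> x \<bullet> e"
proof -
  have cont: "continuous_on A (\<lambda>z. z \<bullet> e)" by (intro continuous_intros)
  obtain x where x: "x \<in> A" "\<And>z. z \<in> A \<Longrightarrow> z \<bullet> e \<le> x \<bullet> e"
    using continuous_attains_sup[OF A(1,2) cont] by blast
  obtain y where y: "y \<in> A" "\<And>z. z \<in> A \<Longrightarrow> y \<bullet> e \<le> z \<bullet> e"
    using continuous_attains_inf[OF A(1,2) cont] by blast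
  define d where "d = (x - y) \<bullet> e"
  have ee: "e \<bullet> e = 1" using e by (simp add: dot_square_norm)
  have "norm ((x - d *\<^sub>R e) - (y + d *\<^sub>R e)) = norm (x - y)"
    using norm_reflect[OF e, of "x - y"] by (simp add: d_def algebra_simps flip: scaleR_add_left)
  moreover have "(x - d *\<^sub>R e) + (y + d *\<^sub>R e) = x + y" by simp
  ultimately consider "x - d *\<^sub>R e \<in> A" | "y + d *\<^sub>R e \<in> A"
    using A(3) x(1) y(1) unfolding diagonal_closed_def by blast
  then show thesis
  proof cases
    case 1
    show ?thesis
      by (rule that[OF x(1) 1]) (use x y in \<open>auto simp: d_def ee inner_diff_left\<close>)
  next
    case 2
    show ?thesis
      by (rule that[OF 2 y(1)]) (use x y in \<open>auto simp: d_def ee inner_diff_left inner_add_left\<close>)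
  qed
qed

lemma quadratic_modulus_imp_constant:
  fixes f :: "real \<Rightarrow> real"
  assumes "\<And>s t. \<bar>f s - f t\<bar> \<le> C * (s - t)\<^sup>2"
  shows "f a = f b"
proof -
  have "(f has_real_derivative 0) (at x)" for x
  proof -
    have "((\<lambda>h. (f (x + h) - f x) / h) \<longlongrightarrow> 0) (at 0)"
    proof (rule Lim_null_comparison)
      show "\<forall>\<^sub>F h in at 0. norm ((f (x + h) - f x) / h) \<le> C * \<bar>h\<bar>"
      proof (rule eventually_at_topological[THEN iffD2], intro exI conjI ballI impI)
        fix h :: real assume "h \<noteq> 0"
        have "\<bar>f (x + h) - f x\<bar> \<le> C * (\<bar>h\<bar> * \<bar>h\<bar>)"
          using assms[of "x + h" x] by (simp add: power2_eq_square)
        then show "norm ((f (x + h) - f x) / h) \<le> C * \<bar>h\<bar>"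
          using \<open>h \<noteq> 0\<close> by (simp add: abs_divide pos_divide_le_eq mult.assoc)
      qed (rule open_UNIV, rule UNIV_I)
      show "((\<lambda>h. C * \<bar>h\<bar>) \<longlongrightarrow> 0) (at 0)"
        by (auto intro!: tendsto_eq_intros)
    qed
    then show ?thesis by (simp add: DERIV_def)
  qed
  then show ?thesis by (intro DERIV_isconst_all) auto
qed

text \<open>
  The width \<open>w\<close> is realised by a chord parallel to the direction, hence
  \<open>w u' \<ge> w u (u \<bullet> u')\<close>. Along a great circle this bounds the increments of \<open>w\<close> by the square of
  the angle, so \<open>w\<close> is constant there. Its value is the diameter, which is the width in the
  direction of a diametral pair.
\<close>

lemma constant_width_chord:
  fixes A :: "'a::euclidean_space set"
  assumes A: "compact A" "A \<noteq> {}" "diagonal_closed A" and D: "diameter A > 0" and e: "norm e = 1"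
  shows "\<exists>x\<in>A. x - diameter A *\<^sub>R e \<in> A \<and> (\<forall>z\<in>A. z \<bullet> e \<le> x \<bullet> e \<and> x \<bullet> e - diameter A \<le> z \<bullet> e)"
proof -
  let ?D = "diameter A"
  have "\<exists>x y. x \<in> A \<and> y \<in> A \<and> x - y = ((x - y) \<bullet> u) *\<^sub>R u \<and>
      (\<forall>z\<in>A. y \<bullet> u \<le> z \<bullet> u \<and> z \<bullet> u \<le> x \<bullet> u)" if "norm u = 1" for u
    using full_width_chord[OF A that] by metis
  then have "\<forall>u. \<exists>x y. norm u = 1 \<longrightarrow> (x \<in> A \<and> y \<in> A \<and> x - y = ((x - y) \<bullet> u) *\<^sub>R u \<and>
      (\<forall>z\<in>A. y \<bullet> u \<le> z \<bullet> u \<and> z \<bullet> u \<le> x \<bullet> u))" by blast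
  then obtain x y where "\<forall>u. norm u = 1 \<longrightarrow> (x u \<in> A \<and> y u \<in> A \<and>
      x u - y u = ((x u - y u) \<bullet> u) *\<^sub>R u \<and> (\<forall>z\<in>A. y u \<bullet> u \<le> z \<bullet> u \<and> z \<bullet> u \<le> x u \<bullet> u))"
    unfolding choice_iff by blast
  then have xy: "\<And>u. norm u = 1 \<Longrightarrow> x u \<in> A" "\<And>u. norm u = 1 \<Longrightarrow> y u \<in> A"
    "\<And>u. norm u = 1 \<Longrightarrow> x u - y u = ((x u - y u) \<bullet> u) *\<^sub>R u"
    "\<And>u z. norm u = 1 \<Longrightarrow> z \<in> A \<Longrightarrow> y u \<bullet> u \<le> z \<bullet> u"
    "\<And>u z. norm u = 1 \<Longrightarrow> z \<in> A \<Longrightarrow> z \<bullet> u \<le> x u \<bullet> u"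
    by blast+
  define w where "w u = (x u - y u) \<bullet> u" for u
  have diam: "norm (a - b) \<le> ?D" if "a \<in> A" "b \<in> A" for a b
    using diameter_bounded_bound[OF compact_imp_bounded[OF A(1)] that] by (simp add: dist_norm)
  have w_ge: "(a - b) \<bullet> u \<le> w u" if "norm u = 1" "a \<in> A" "b \<in> A" for a b u
    using xy(4)[OF that(1,3)] xy(5)[OF that(1,2)] by (simp add: w_def inner_diff_left)
  have w_nonneg: "0 \<le> w u" if "norm u = 1" for u
    using w_ge[OF that xy(1)[OF that] xy(1)[OF that]] by simp
  have w_le: "w u \<le> ?D" if "norm u = 1" for u
    using norm_cauchy_schwarz[of "x u - y u" u] diam[OF xy(1)[OF that] xy(2)[OF that]] that
    by (simp add: w_def)
  have w_cmp: "w u * (u \<bullet> u') \<le> w u'" if "norm u = 1" "norm u' = 1" for u u'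
  proof -
    have "(x u - y u) \<bullet> u' \<le> w u'" using w_ge that xy by blast
    moreover have "(x u - y u) \<bullet> u' = w u * (u \<bullet> u')"
      using xy(3)[OF that(1)] unfolding w_def by (metis inner_scaleR_left)
    ultimately show ?thesis by simp
  qed
  obtain a b where ab: "a \<in> A" "b \<in> A" "norm (a - b) = ?D"
    using diameter_compact_attained[OF A(1,2)] by (auto simp: dist_norm)
  define e0 where "e0 = (a - b) /\<^sub>R ?D"
  have e0: "norm e0 = 1" using ab D by (simp add: e0_def)
  have "(a - b) \<bullet> e0 = ?D"
    using ab D by (simp add: e0_def dot_square_norm power2_eq_square)
  then have we0: "w e0 = ?D" using w_ge[OF e0 ab(1,2)] w_le[OF e0] by simp
  have "w e = ?D"
  proof -
    define c where "c = e \<bullet> e0"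
    define f where "f = e - c *\<^sub>R e0"
    have ee: "e \<bullet> e = 1" "e0 \<bullet> e0 = 1" using e e0 by (simp_all add: dot_square_norm)
    have fe0: "f \<bullet> e0 = 0" by (simp add: f_def c_def inner_diff_left ee)
    have ff: "f \<bullet> f = 1 - c\<^sup>2"
      by (simp add: f_def inner_diff_left inner_diff_right ee c_def inner_commute power2_eq_square)
    show ?thesis
    proof (cases "f = 0")
      case True
      then have "e = c *\<^sub>R e0" "c\<^sup>2 = 1" using ff by (auto simp: f_def)
      then consider "e = e0" | "e = - e0" by (auto simp: power2_eq_1_iff)
      then show ?thesis
      proof cases
        case 2
        have "(b - a) \<bullet> e = ?D" using \<open>(a - b) \<bullet> e0 = ?D\<close> 2 by (simp add: inner_diff_left)
        then show ?thesis using w_ge[OF e ab(2,1)] w_le[OF e] by simp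
      qed (use we0 in simp)
    next
      case False
      define g where "g = f /\<^sub>R norm f"
      have g: "g \<bullet> g = 1" "g \<bullet> e0 = 0" "e0 \<bullet> g = 0"
        using False fe0 by (auto simp: g_def dot_square_norm power2_eq_square inner_commute field_simps)
      have c1: "\<bar>c\<bar> \<le> 1" using Cauchy_Schwarz_ineq2[of e e0] e e0 by (simp add: c_def)
      define \<theta> where "\<theta> t = cos t *\<^sub>R e0 + sin t *\<^sub>R g" for t
      have in_\<theta>: "\<theta> s \<bullet> \<theta> t = cos (s - t)" for s t
        by (simp add: \<theta>_def inner_add_left inner_add_right g ee cos_diff)
      have n\<theta>: "norm (\<theta> t) = 1" for t by (simp add: norm_eq_sqrt_inner in_\<theta>)
      have one: "w (\<theta> s) - w (\<theta> t) \<le> (?D / 2) * (s - t)\<^sup>2" for s t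
      proof -
        define h where "h = (s - t) / 2"
        have h: "s - t = 2 * h" by (simp add: h_def)
        have "(sin h)\<^sup>2 \<le> h\<^sup>2"
          using abs_sin_x_le_abs_x[of h] by (simp only: abs_le_square_iff)
        then have "cos (s - t) \<ge> 1 - (s - t)\<^sup>2 / 2"
          unfolding h cos_double_sin by (simp add: power2_eq_square)
        then have "w (\<theta> s) * (1 - (s - t)\<^sup>2 / 2) \<le> w (\<theta> s) * cos (s - t)"
          by (rule mult_left_mono) (rule w_nonneg[OF n\<theta>])
        also have "\<dots> \<le> w (\<theta> t)" using w_cmp[OF n\<theta> n\<theta>, of s t] by (simp add: in_\<theta>)
        finally have "w (\<theta> s) - w (\<theta> t) \<le> w (\<theta> s) * ((s - t)\<^sup>2 / 2)" by (simp add: algebra_simps)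
        also have "\<dots> \<le> ?D * ((s - t)\<^sup>2 / 2)" by (intro mult_right_mono w_le n\<theta>) auto
        finally show ?thesis by simp
      qed
      have "w (\<theta> 0) = w (\<theta> (arccos c))"
      proof (rule quadratic_modulus_imp_constant[where f = "\<lambda>t. w (\<theta> t)"])
        show "\<bar>w (\<theta> s) - w (\<theta> t)\<bar> \<le> (?D / 2) * (s - t)\<^sup>2" for s t
          using one[of s t] one[of t s] unfolding power2_commute[of t s] by linarith
      qed
      moreover have "\<theta> 0 = e0" by (simp add: \<theta>_def)
      moreover have "\<theta> (arccos c) = e"
      proof -
        have "norm f = sqrt (1 - c\<^sup>2)" using ff by (simp add: norm_eq_sqrt_inner)
        then have "sin (arccos c) = norm f" using c1 by (simp add: sin_arccos)
        then show ?thesis using False c1 by (simp add: \<theta>_def g_def cos_arccos f_def)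
      qed
      ultimately show ?thesis using we0 by simp
    qed
  qed
  then have "x e - ?D *\<^sub>R e = y e" using xy(3)[OF e] by (simp add: w_def algebra_simps)
  moreover have "x e \<bullet> e - ?D = y e \<bullet> e" using \<open>w e = ?D\<close> by (simp add: w_def inner_diff_left)
  ultimately show ?thesis using xy(1,2,4,5)[OF e] by (intro bexI[of _ "x e"]) auto
qed


text \<open>
  \<open>X u\<close> is the point of \<open>A\<close> that is highest in direction \<open>u\<close>, and \<open>M u\<close> is the midpoint of the chord of full
  width in that direction. That chord for \<open>e\<close> and the segment obtained by turning it about \<open>M e\<close> into direction
  \<open>u\<close> are the diagonals of a rectangle, so one end of the latter lies in \<open>A\<close>. If \<open>M e\<close> and
  \<open>M u\<close> have the same height in direction \<open>u\<close>, that end is extremal in \<open>A\<close>, hence an end of the chord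
  for \<open>u\<close>; this is \<open>M_eq\<close>.

  If \<open>M\<close> is not constant, there are orthogonal unit vectors \<open>a\<close>, \<open>b\<close> for which
  \<open>k s = (M \<theta> - M a) \<bullet> (s a + b)\<close>, with \<open>\<theta>\<close> the normalization of \<open>s a + b\<close>, is positive somewhere.
  It is bounded above by \<open>D / \<bar>s\<bar>\<close> and thus has a maximum. The derivative there is
  \<open>(M \<theta> - M a) \<bullet> a\<close>. As it vanishes, \<open>M_eq\<close> gives \<open>M \<theta> = M a\<close>, so the maximum is \<open>0\<close>.
\<close>

lemma sphere_of_diagonal_closed:
  fixes A :: "'a::euclidean_space set"
  assumes A: "compact A" "A \<noteq> {}" "diagonal_closed A" and D: "diameter A > 0"
  shows "\<exists>c. A \<subseteq> cball c (diameter A / 2) \<and> sphere c (diameter A / 2) \<subseteq> A"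
proof -
  let ?D = "diameter A"
  have "\<forall>u. \<exists>x. norm u = 1 \<longrightarrow> (x \<in> A \<and> x - ?D *\<^sub>R u \<in> A \<and>
      (\<forall>z\<in>A. z \<bullet> u \<le> x \<bullet> u \<and> x \<bullet> u - ?D \<le> z \<bullet> u))"
    using constant_width_chord[OF A D] by blast
  then obtain X where "\<forall>u. norm u = 1 \<longrightarrow> (X u \<in> A \<and> X u - ?D *\<^sub>R u \<in> A \<and>
      (\<forall>z\<in>A. z \<bullet> u \<le> X u \<bullet> u \<and> X u \<bullet> u - ?D \<le> z \<bullet> u))"
    unfolding choice_iff by blast
  then have X: "\<And>u. norm u = 1 \<Longrightarrow> X u \<in> A" "\<And>u. norm u = 1 \<Longrightarrow> X u - ?D *\<^sub>R u \<in> A"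
    "\<And>u z. norm u = 1 \<Longrightarrow> z \<in> A \<Longrightarrow> z \<bullet> u \<le> X u \<bullet> u"
    "\<And>u z. norm u = 1 \<Longrightarrow> z \<in> A \<Longrightarrow> X u \<bullet> u - ?D \<le> z \<bullet> u"
    by blast+
  have unit: "u \<bullet> u = 1" if "norm u = 1" for u :: 'a using that by (simp add: dot_square_norm)
  \<comment> \<open>\<open>A\<close> lies in the ball of radius \<open>D\<close> about the lower end of the chord; this makes highest points unique and \<open>X\<close> Lipschitz.\<close>
  have near: "(norm (z - X u))\<^sup>2 \<le> 2 * ?D * ((X u - z) \<bullet> u)" if u: "norm u = 1" and z: "z \<in> A" for u z
  proof -
    have "norm (z - (X u - ?D *\<^sub>R u)) \<le> ?D"
      using diameter_bounded_bound[OF compact_imp_bounded[OF A(1)] z X(2)[OF u]] by (simp add: dist_norm)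
    then have "(norm ((z - X u) + ?D *\<^sub>R u))\<^sup>2 \<le> ?D\<^sup>2"
      by (intro power_mono) (simp_all add: algebra_simps)
    moreover have "(norm ((z - X u) + ?D *\<^sub>R u))\<^sup>2 =
        (norm (z - X u))\<^sup>2 + 2 * ?D * ((z - X u) \<bullet> u) + ?D\<^sup>2"
      unfolding power2_norm_eq_inner
      by (simp only: inner_add_left inner_add_right inner_scaleR_left inner_scaleR_right unit[OF u])
        (simp add: inner_commute power2_eq_square algebra_simps)
    ultimately have "(norm (z - X u))\<^sup>2 + 2 * ?D * ((z - X u) \<bullet> u) \<le> 0" by simp
    then show ?thesis by (simp add: inner_diff_left algebra_simps)
  qed
  have unique: "z = X u" if "norm u = 1" "z \<in> A" "z \<bullet> u = X u \<bullet> u" for u z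
    using near[OF that(1,2)] that(3) by (simp add: inner_diff_left)
  have X_minus: "X (- u) = X u - ?D *\<^sub>R u" if u: "norm u = 1" for u
  proof -
    have u': "norm (- u) = 1" using u by simp
    have "(X u - ?D *\<^sub>R u) \<bullet> (- u) = X (- u) \<bullet> (- u)"
      using X(3)[OF u' X(2)[OF u]] X(4)[OF u X(1)[OF u']]
      by (simp add: inner_diff_left unit[OF u])
    then show ?thesis using unique[OF u' X(2)[OF u]] by simp
  qed
  define M where "M u = X u - (?D / 2) *\<^sub>R u" for u
  have M_minus: "M (- u) = M u" if "norm u = 1" for u
    using X_minus[OF that] by (simp add: M_def algebra_simps flip: scaleR_add_left)
  have M_eq: "M e = M u" if e: "norm e = 1" and u: "norm u = 1" and eq: "(M e - M u) \<bullet> u = 0" for e u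
  proof -
    have Xe: "X e = M e + (?D / 2) *\<^sub>R e" "X (- e) = M e - (?D / 2) *\<^sub>R e"
      using X_minus[OF e] by (simp_all add: M_def algebra_simps flip: scaleR_add_left)
    have Xu: "X u = M u + (?D / 2) *\<^sub>R u" "X (- u) = M u - (?D / 2) *\<^sub>R u"
      using X_minus[OF u] by (simp_all add: M_def algebra_simps flip: scaleR_add_left)
    have eu: "norm (- e) = 1" "norm (- u) = 1" using e u by simp_all
    let ?p = "M e + (?D / 2) *\<^sub>R u" and ?q = "M e - (?D / 2) *\<^sub>R u"
    have "?p + ?q = X e + X (- e)" by (simp add: Xe)
    moreover have "norm (?p - ?q) = norm (X e - X (- e))"
      using e u by (simp add: Xe flip: scaleR_add_left)
    ultimately consider "?p \<in> A" | "?q \<in> A"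
      using A(3) X(1)[OF e] X(1)[OF eu(1)] unfolding diagonal_closed_def by blast
    then show ?thesis
    proof cases
      case 1
      then have "?p = X u" using eq by (intro unique u) (auto simp: Xu inner_add_left inner_diff_left)
      then show ?thesis by (simp add: Xu)
    next
      case 2
      then have "?q = X (- u)" using eq by (intro unique eu) (auto simp: Xu inner_diff_left)
      then show ?thesis by (simp add: Xu)
    qed
  qed
  have X_lip: "norm (X e - X u) \<le> ?D * norm (e - u)" if e: "norm e = 1" and u: "norm u = 1" for e u
  proof -
    have "2 * (norm (X e - X u))\<^sup>2 \<le> 2 * ?D * ((X e - X u) \<bullet> (e - u))"
      using near[OF e X(1)[OF u]] near[OF u X(1)[OF e]]
      by (simp add: norm_minus_commute inner_diff_left inner_diff_right algebra_simps)
    also have "\<dots> \<le> 2 * ?D * (norm (X e - X u) * norm (e - u))"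
      using D by (intro mult_left_mono norm_cauchy_schwarz) auto
    finally have "norm (X e - X u) * norm (X e - X u) \<le> norm (X e - X u) * (?D * norm (e - u))"
      by (simp add: power2_eq_square algebra_simps)
    then show ?thesis using D by (cases "norm (X e - X u) = 0") auto
  qed
  have contM: "continuous_on (sphere 0 1) M"
  proof -
    have "?D-lipschitz_on (sphere 0 1) X"
      using X_lip D by (intro lipschitz_onI) (auto simp: dist_norm)
    then show ?thesis unfolding M_def by (intro continuous_intros lipschitz_on_continuous_on)
  qed
  have M_upper: "(M e - M a) \<bullet> e \<le> ?D * (2 - 2 * (e \<bullet> a))" if e: "norm e = 1" and a: "norm a = 1" for e a
  proof -
    have "(M e - M a) \<bullet> e = (X e - X a) \<bullet> e - ?D / 2 * (1 - e \<bullet> a)"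
    proof -
      have "M e - M a = (X e - X a) - (?D / 2) *\<^sub>R (e - a)"
        by (simp add: M_def scaleR_right_diff_distrib)
      moreover have "(e - a) \<bullet> e = 1 - e \<bullet> a"
        by (simp add: inner_diff_left unit[OF e] inner_commute[of a e])
      ultimately show ?thesis
        by (simp only: inner_diff_left[of "X e - X a"] inner_scaleR_left)
    qed
    also have "\<dots> \<le> (X e - X a) \<bullet> e"
      using D norm_cauchy_schwarz[of e a] e a by simp
    also have "\<dots> = (X e - X a) \<bullet> a + (X e - X a) \<bullet> (e - a)" by (simp add: inner_diff_right)
    also have "\<dots> \<le> 0 + norm (X e - X a) * norm (e - a)"
      using X(3)[OF a X(1)[OF e]] by (intro add_mono norm_cauchy_schwarz) (simp add: inner_diff_left)
    also have "\<dots> \<le> ?D * norm (e - a) * norm (e - a)"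
      using X_lip[OF e a] by (simp add: mult_right_mono)
    also have "norm (e - a) * norm (e - a) = 2 - 2 * (e \<bullet> a)"
      by (simp add: power2_norm_eq_inner inner_diff_left inner_diff_right unit e a inner_commute
          flip: power2_eq_square)
    then have "?D * norm (e - a) * norm (e - a) = ?D * (2 - 2 * (e \<bullet> a))" by (simp add: mult.assoc)
    finally show ?thesis .
  qed
  have key: "(M ((1 / sqrt (1 + s0\<^sup>2)) *\<^sub>R (s0 *\<^sub>R a + b)) - M a) \<bullet> (s0 *\<^sub>R a + b) \<le> 0"
    if a: "norm a = 1" and b: "norm b = 1" and ab: "a \<bullet> b = 0" for a b s0
  proof (rule ccontr)
    define r where "r s = sqrt (1 + s\<^sup>2)" for s :: real
    define u where "u s = s *\<^sub>R a + b" for s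
    define \<theta> where "\<theta> s = (1 / r s) *\<^sub>R u s" for s
    define k where "k s = (M (\<theta> s) - M a) \<bullet> u s" for s
    assume "\<not> ?thesis"
    then have k0: "k s0 > 0" by (simp add: k_def \<theta>_def u_def r_def)
    have r: "r s > 0" "r s * r s = 1 + s\<^sup>2" for s
      by (simp_all add: r_def add_pos_nonneg)
    have aa: "a \<bullet> a = 1" "b \<bullet> b = 1" "b \<bullet> a = 0" using a b ab by (simp_all add: unit inner_commute)
    have uu: "u s \<bullet> u s = r s * r s" "u s \<bullet> a = s" for s
      by (simp_all add: u_def inner_add_left inner_add_right aa ab r(2) power2_eq_square)
    have nu: "norm (u s) = r s" for s using r(1)[of s] by (simp add: norm_eq_sqrt_inner uu)
    have n\<theta>: "norm (\<theta> s) = 1" for s using r(1)[of s] by (simp add: \<theta>_def nu)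
    have u\<theta>: "u s = r s *\<^sub>R \<theta> s" for s using r(1)[of s] by (simp add: \<theta>_def)
    have k_\<theta>: "k s = r s * ((M (\<theta> s) - M a) \<bullet> \<theta> s)" for s by (simp add: k_def u\<theta>[of s])
    have k_small: "k s \<le> ?D / \<bar>s\<bar>" if "s \<noteq> 0" for s
    proof -
      define \<sigma> where "\<sigma> = sgn s"
      have \<sigma>: "\<bar>\<sigma>\<bar> = 1" "\<sigma> * s = \<bar>s\<bar>" "\<sigma> = 1 \<or> \<sigma> = - 1" using that by (auto simp: \<sigma>_def sgn_if)
      have "(M (\<theta> s) - M (\<sigma> *\<^sub>R a)) \<bullet> \<theta> s \<le> ?D * (2 - 2 * (\<theta> s \<bullet> (\<sigma> *\<^sub>R a)))"
        using \<sigma> a by (intro M_upper n\<theta>) simp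
      moreover have "M (\<sigma> *\<^sub>R a) = M a" using \<sigma>(3) M_minus[OF a] by auto
      moreover have "\<theta> s \<bullet> (\<sigma> *\<^sub>R a) = \<bar>s\<bar> / r s" using \<sigma>(2) by (simp add: \<theta>_def uu)
      ultimately have "k s \<le> r s * (?D * (2 - 2 * (\<bar>s\<bar> / r s)))"
        unfolding k_\<theta> using r(1)[of s] by (intro mult_left_mono) auto
      also have "\<dots> = ?D * (2 * r s - 2 * \<bar>s\<bar>)" using r(1)[of s] by (simp add: field_simps)
      also have "\<dots> \<le> ?D * (1 / \<bar>s\<bar>)"
      proof (rule mult_left_mono)
        have "r s \<le> \<bar>s\<bar> + 1 / (2 * \<bar>s\<bar>)"
          unfolding r_def using that by (intro real_le_lsqrt) (auto simp: power2_eq_square field_simps)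
        then show "2 * r s - 2 * \<bar>s\<bar> \<le> 1 / \<bar>s\<bar>" by simp
      qed (use D in simp)
      finally show ?thesis by simp
    qed
    define L where "L = ?D / k s0 + \<bar>s0\<bar> + 1"
    have L: "L > 0" "\<bar>s0\<bar> \<le> L" "?D / k s0 < L" using D k0 by (auto simp: L_def add_pos_nonneg add_nonneg_pos)
    have contk: "continuous_on {- L..L} k"
    proof -
      have c\<theta>: "continuous_on {- L..L} \<theta>"
        unfolding \<theta>_def u_def r_def
        by (intro continuous_intros) (auto simp: add_nonneg_eq_0_iff)
      have "continuous_on {- L..L} (\<lambda>s. M (\<theta> s))"
        by (rule continuous_on_compose2[OF contM c\<theta>]) (auto simp: n\<theta>)
      then show ?thesis unfolding k_def u_def by (intro continuous_intros)
    qed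
    obtain t where t: "t \<in> {- L..L}" "\<And>s. s \<in> {- L..L} \<Longrightarrow> k s \<le> k t"
      using continuous_attains_sup[OF _ _ contk] L by fastforce
    have kt: "k t > 0" using t(2)[of s0] k0 L(2) by (auto simp: abs_le_iff)
    have max: "k s \<le> k t" for s
    proof (cases "s \<in> {- L..L}")
      case False
      then have s: "\<bar>s\<bar> > L" by (auto simp: abs_if)
      then have "k s \<le> ?D / \<bar>s\<bar>" using L(1) by (intro k_small) auto
      also have "\<dots> \<le> ?D / (?D / k s0)"
        using s L D k0 by (intro divide_left_mono) auto
      also have "\<dots> = k s0" using D by simp
      also have "\<dots> \<le> k t" using L(2) by (intro t(2)) auto
      finally show ?thesis .
    qed (rule t(2))
    \<comment> \<open>Freezing \<open>X\<close> at the maximum gives a minorant of \<open>k\<close> that touches it there and is differentiable without any smoothness of \<open>M\<close>.\<close>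
    define f where "f s = (X (\<theta> t) - M a) \<bullet> u s - ?D / 2 * r s" for s
    have k_X: "k s = (X (\<theta> s) - M a) \<bullet> u s - ?D / 2 * r s" for s
    proof -
      have "\<theta> s \<bullet> u s = r s" using r(1)[of s] by (simp add: \<theta>_def uu)
      then show ?thesis by (simp add: k_def M_def inner_diff_left)
    qed
    have "f s \<le> f t" for s
    proof -
      have "X (\<theta> t) \<bullet> \<theta> s \<le> X (\<theta> s) \<bullet> \<theta> s" by (intro X n\<theta>)
      then have "X (\<theta> t) \<bullet> u s \<le> X (\<theta> s) \<bullet> u s"
        unfolding u\<theta>[of s] using r(1)[of s] by (simp add: mult_left_mono)
      then have "f s \<le> k s" unfolding f_def k_X by (simp add: inner_diff_left)
      also have "k s \<le> k t" by (rule max)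
      also have "k t = f t" by (simp add: f_def k_X)
      finally show ?thesis .
    qed
    moreover have "(f has_real_derivative ((X (\<theta> t) - M a) \<bullet> a - ?D / 2 * (t / r t))) (at t)"
    proof -
      have f_eq: "f = (\<lambda>s. s * ((X (\<theta> t) - M a) \<bullet> a) + (X (\<theta> t) - M a) \<bullet> b - ?D / 2 * sqrt (1 + s\<^sup>2))"
        by (simp add: f_def u_def r_def inner_add_right fun_eq_iff)
      have "1 + t\<^sup>2 > 0" by (simp add: add_pos_nonneg)
      then show ?thesis unfolding f_eq r_def
        by (auto intro!: derivative_eq_intros simp: field_simps)
    qed
    ultimately have "(X (\<theta> t) - M a) \<bullet> a - ?D / 2 * (t / r t) = 0"
      by (intro DERIV_local_max[of f _ t 1]) auto
    moreover have "\<theta> t \<bullet> a = t / r t" by (simp add: \<theta>_def uu)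
    ultimately have "(M (\<theta> t) - M a) \<bullet> a = 0" by (simp add: M_def inner_diff_left)
    then have "M (\<theta> t) = M a" by (rule M_eq[OF n\<theta> a])
    then show False using kt by (simp add: k_def)
  qed
  have le0: "(M e - M a) \<bullet> e \<le> 0" if e: "norm e = 1" and a: "norm a = 1" for e a
  proof -
    define c where "c = e \<bullet> a"
    define f where "f = e - c *\<^sub>R a"
    have fa: "a \<bullet> f = 0" by (simp add: f_def c_def inner_diff_right unit[OF a] inner_commute)
    have ff: "f \<bullet> f = 1 - c\<^sup>2"
      by (simp add: f_def inner_diff_left inner_diff_right unit e a c_def inner_commute power2_eq_square)
    show ?thesis
    proof (cases "f = 0")
      case True
      then have "e = c *\<^sub>R a" "c\<^sup>2 = 1" using ff by (auto simp: f_def)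
      then have "e = a \<or> e = - a" by (auto simp: power2_eq_1_iff)
      then show ?thesis using M_minus[OF a] by auto
    next
      case False
      define n where "n = norm f"
      have n: "n > 0" "n\<^sup>2 = 1 - c\<^sup>2" using False ff by (auto simp: n_def power2_norm_eq_inner)
      have "1 + (c / n)\<^sup>2 = (1 / n)\<^sup>2" using n by (simp add: power_divide field_simps)
      then have rt: "1 / sqrt (1 + (c / n)\<^sup>2) = n" using n by (simp add: real_sqrt_divide)
      have ue: "(c / n) *\<^sub>R a + f /\<^sub>R n = (1 / n) *\<^sub>R e"
        by (simp add: f_def algebra_simps divide_inverse_commute)
      have "(M (n *\<^sub>R ((1 / n) *\<^sub>R e)) - M a) \<bullet> ((1 / n) *\<^sub>R e) \<le> 0"
        using key[of a "f /\<^sub>R n" "c / n"] a False fa unfolding rt ue by (simp add: n_def)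
      then show ?thesis using n(1) by (simp add: divide_le_0_iff mult_le_0_iff)
    qed
  qed
  obtain a :: 'a where a: "norm a = 1" using vector_choose_size[of 1] by auto
  have M_const: "M e = M a" if e: "norm e = 1" for e
  proof -
    have "(M e - M a) \<bullet> e = 0"
      using le0[OF e a] le0[of "- e" a] e a M_minus[OF e] by simp
    then have "(M a - M e) \<bullet> e = 0" by (simp add: inner_diff_left)
    then show ?thesis using M_eq[OF a e] by simp
  qed
  have X_eq: "X e = M a + (?D / 2) *\<^sub>R e" if "norm e = 1" for e
    using M_const[OF that] by (simp add: M_def algebra_simps)
  show ?thesis
  proof (intro exI conjI subsetI)
    fix z assume z: "z \<in> A"
    show "z \<in> cball (M a) (?D / 2)"
    proof (cases "z = M a")
      case False
      define e where "e = (z - M a) /\<^sub>R norm (z - M a)"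
      have e: "norm e = 1" using False by (simp add: e_def)
      have "norm (z - M a) = (z - M a) \<bullet> e"
        using False by (simp add: e_def dot_square_norm power2_eq_square)
      also have "\<dots> \<le> (X e - M a) \<bullet> e" using X(3)[OF e z] by (simp add: inner_diff_left)
      also have "\<dots> = ?D / 2" by (simp add: X_eq[OF e] unit[OF e])
      finally show ?thesis by (simp add: dist_norm norm_minus_commute)
    qed (use D in simp)
  next
    fix z assume "z \<in> sphere (M a) (?D / 2)"
    then have z: "norm (z - M a) = ?D / 2" by (simp add: dist_norm norm_minus_commute)
    define e where "e = (2 / ?D) *\<^sub>R (z - M a)"
    have e: "norm e = 1" using z D by (simp add: e_def)
    have "X e = z" unfolding X_eq[OF e] using D by (simp add: e_def)
    then show "z \<in> A" using X(1)[OF e] by simp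
  qed
qed

section \<open>Recognizing the ball\<close>

text \<open>
  A rectangle with one diagonal in the open set \<open>U\<close> and the other in the exterior of \<open>U\<close> keeps this
  property for all nearby centres, which contradicts the absence of crossings. The remaining case,
  with diagonal ends on the boundary of \<open>U\<close>, follows by continuity of \<open>post1\<close> and \<open>post2\<close> for a fixed direction.
\<close>

lemma diagonal_closed_closure:
  fixes S U :: "'a::euclidean_space set"
  assumes cf: "crossing_free S" and U: "open U" "AE x in lborel. x \<in> S \<longleftrightarrow> x \<in> U"
  shows "diagonal_closed (closure U)"
proof -
  have inner: "post1 v w s \<in> closure U \<or> post2 v w s \<in> closure U"
    if vw: "v \<in> U" "w \<in> U" and s: "norm s = 1" for v w s
  proof (rule ccontr)
    assume out: "\<not> ?thesis"
    define c where "c = (v + w) /\<^sub>R 2"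
    define a where "a = (v - w) /\<^sub>R 2"
    define b where "b = (norm (v - w) / 2) *\<^sub>R s"
    have ca: "v = c + a" "w = c - a"
      by (simp_all add: c_def a_def algebra_simps flip: scaleR_add_left)
    define V where "V = (\<lambda>x. x + a) -` U \<inter> (\<lambda>x. x - a) -` U \<inter>
      ((\<lambda>x. x + b) -` (- closure U) \<inter> (\<lambda>x. x - b) -` (- closure U))"
    have "open V" unfolding V_def
      by (intro open_Int open_vimage U open_Compl closed_closure continuous_intros)
    moreover have "c \<in> V"
    proof -
      have "c + b = post1 v w s" "c - b = post2 v w s"
        by (simp_all add: c_def b_def post1_def post2_def)
      then show ?thesis using out vw by (simp add: V_def flip: ca)
    qed
    moreover have "norm a = norm b" using s by (simp add: a_def b_def)
    then have "AE x in lborel. \<not> crossing_at S a b x" using cf by (auto simp: crossing_free_def)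
    moreover have tr: "AE x in lborel. x + d \<in> S \<longleftrightarrow> x + d \<in> U" for d
      by (rule AE_lborel_translate[OF U(2)])
    have "AE x in lborel. x \<notin> V"
      using tr[of a] tr[of "- a"] tr[of b] tr[of "- b"] \<open>AE x in lborel. \<not> crossing_at S a b x\<close>
    proof eventually_elim
      case (elim x)
      then show ?case using closure_subset[of U] by (auto simp: V_def crossing_at_def)
    qed
    ultimately show False using AE_lborel_ex[OF \<open>AE x in lborel. x \<notin> V\<close> \<open>open V\<close>] by blast
  qed
  have outer: "post1 v w s \<in> closure U \<or> post2 v w s \<in> closure U"
    if vw: "v \<in> closure U" "w \<in> closure U" and s: "norm s = 1" for v w s
  proof -
    define K where "K = (\<lambda>p. post1 (fst p) (snd p) s) -` closure U \<union> (\<lambda>p. post2 (fst p) (snd p) s) -` closure U"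
    have "closed K" unfolding K_def post1_def post2_def
      by (intro closed_Un closed_vimage closed_closure continuous_intros) auto
    moreover have "U \<times> U \<subseteq> K" using inner[OF _ _ s] unfolding K_def by fastforce
    ultimately have "closure (U \<times> U) \<subseteq> K" by (rule closure_minimal[rotated])
    then have "(v, w) \<in> K" using vw by (auto simp: closure_Times)
    then show ?thesis by (simp add: K_def)
  qed
  show ?thesis unfolding diagonal_closed_def
  proof (intro ballI allI impI)
    fix v w p q assume vw: "v \<in> closure U" "w \<in> closure U" and pq: "p + q = v + w" "norm (p - q) = norm (v - w)"
    show "p \<in> closure U \<or> q \<in> closure U"
    proof (cases "p = q")
      case True
      then have "v = w" using pq(2) by simp
      then have "2 *\<^sub>R p = 2 *\<^sub>R v" using pq(1) True by (simp add: scaleR_2)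
      then show ?thesis using vw by simp
    next
      case False
      define s where "s = (p - q) /\<^sub>R norm (p - q)"
      have "norm s = 1" using False by (simp add: s_def)
      moreover have "(norm (v - w) / 2) *\<^sub>R s = (p - q) /\<^sub>R 2"
        using False by (simp add: s_def flip: pq(2))
      then have "post1 v w s = (p + q) /\<^sub>R 2 + (p - q) /\<^sub>R 2"
        "post2 v w s = (p + q) /\<^sub>R 2 - (p - q) /\<^sub>R 2"
        by (simp_all only: post1_def post2_def pq(1))
      then have "post1 v w s = p" "post2 v w s = q"
        by (simp_all flip: scaleR_add_right scaleR_diff_right)
      ultimately show ?thesis using outer[OF vw, of s] by simp
    qed
  qed
qed

lemma cball_subset_if_sphere_subset:
  fixes c :: "'a::euclidean_space"
  assumes A: "convex A" "sphere c r \<subseteq> A" and "r > 0"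
  shows "cball c r \<subseteq> A"
proof
  fix z assume z: "z \<in> cball c r"
  obtain e where e: "norm e = 1" "z - c = norm (z - c) *\<^sub>R e"
  proof (cases "z = c")
    case True
    obtain e :: 'a where "norm e = 1" using vector_choose_size[of 1] by auto
    then show ?thesis using that True by simp
  next
    case False
    then show ?thesis using that[of "(z - c) /\<^sub>R norm (z - c)"] by simp
  qed
  define t where "t = norm (z - c) / r"
  have t: "0 \<le> t" "t \<le> 1" using z \<open>r > 0\<close> by (auto simp: t_def dist_norm norm_minus_commute)
  have "c + r *\<^sub>R e \<in> A" "c - r *\<^sub>R e \<in> A" using A(2) e(1) \<open>r > 0\<close> by (auto simp: subset_eq dist_norm)
  then have "((1 + t) / 2) *\<^sub>R (c + r *\<^sub>R e) + ((1 - t) / 2) *\<^sub>R (c - r *\<^sub>R e) \<in> A"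
    using A(1) t by (intro convexD) (auto simp: field_simps)
  also have "((1 + t) / 2) *\<^sub>R (c + r *\<^sub>R e) + ((1 - t) / 2) *\<^sub>R (c - r *\<^sub>R e)
      = ((1 + t) / 2 + (1 - t) / 2) *\<^sub>R c + (((1 + t) / 2 - (1 - t) / 2) * r) *\<^sub>R e"
    by (simp add: algebra_simps)
  also have "(1 + t) / 2 + (1 - t) / 2 = 1" by (simp add: field_simps)
  also have "((1 + t) / 2 - (1 - t) / 2) * r = norm (z - c)" using \<open>r > 0\<close> by (simp add: t_def field_simps)
  also have "1 *\<^sub>R c + norm (z - c) *\<^sub>R e = z" using e(2) by (simp add: algebra_simps)
  finally show "z \<in> A" .
qed

lemma crossing_free_imp_ball:
  fixes S :: "'a::euclidean_space set"
  assumes dim: "DIM('a) \<ge> 2"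
    and S: "S \<in> sets borel" and fin: "emeasure lborel S < \<infinity>" and pos: "emeasure lborel S \<noteq> 0"
    and cf: "crossing_free S"
  shows "\<exists>c r. r > 0 \<and> (AE x in lborel. x \<in> S \<longleftrightarrow> x \<in> cball c r)"
proof -
  obtain U where U: "open U" "convex U" "AE x in lborel. x \<in> S \<longleftrightarrow> x \<in> U"
    using AE_midpoint_convex_imp_open_convex[OF S fin crossing_free_midpoint[OF dim S fin cf]] by blast
  have SU: "emeasure lborel S = emeasure lborel U"
    by (rule emeasure_eq_AE[OF U(3)]) (use S U(1) in auto)
  have "bounded U" using open_convex_finite_measure_bounded[OF U(1,2)] fin SU by simp
  then have A: "compact (closure U)" by simp
  have "U \<noteq> {}" using pos SU by auto
  then obtain x e where xe: "e > 0" "cball x e \<subseteq> U" using U(1) by (meson ex_in_conv open_contains_cball)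
  obtain b :: 'a where b: "norm b = 1" using vector_choose_size[of 1] by auto
  have "x \<in> closure U" "x + e *\<^sub>R b \<in> closure U"
    using xe b closure_subset[of U] by (auto simp: subset_eq dist_norm)
  then have "dist x (x + e *\<^sub>R b) \<le> diameter (closure U)"
    using diameter_bounded_bound[OF compact_imp_bounded[OF A]] by blast
  then have D: "diameter (closure U) > 0" using xe(1) b by (simp add: dist_norm)
  obtain c where c: "closure U \<subseteq> cball c (diameter (closure U) / 2)"
    "sphere c (diameter (closure U) / 2) \<subseteq> closure U"
    using sphere_of_diagonal_closed[OF A _ diagonal_closed_closure[OF cf U(1,3)] D] \<open>U \<noteq> {}\<close> by auto
  define r where "r = diameter (closure U) / 2"
  have r: "r > 0" using D by (simp add: r_def)
  have eq: "closure U = cball c r"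
    using cball_subset_if_sphere_subset[OF convex_closure[OF U(2)] c(2)] c(1) D by (simp add: r_def)
  have "frontier U \<in> null_sets lebesgue"
    using negligible_convex_frontier[OF U(2)] by (simp add: negligible_iff_null_sets)
  then have "AE x in lebesgue. x \<notin> frontier U" by (rule AE_not_in)
  then have "AE x in lborel. x \<notin> frontier U" by (simp add: AE_completion_iff)
  with U(3) have "AE x in lborel. x \<in> S \<longleftrightarrow> x \<in> cball c r"
  proof eventually_elim
    case (elim x)
    then show ?case
      using U(1) closure_subset[of U] unfolding eq[symmetric]
      by (auto simp: frontier_def interior_open)
  qed
  then show ?thesis using r by blast
qed

theorem theorem4p2:
  fixes E :: "(real ^ 'n) set"
  assumes "CARD('n) \<ge> 2"
    and "E \<in> sets lebesgue"
    and "0 < emeasure lebesgue E" and "emeasure lebesgue E < \<infinity>"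
    and "AE (v, w, s) in completion (lborel \<Otimes>\<^sub>M lborel \<Otimes>\<^sub>M sphere_measure).
           indicat_real E v * indicat_real E w
             * (1 - indicat_real E (post1 v w s)) * (1 - indicat_real E (post2 v w s)) = 0"
  shows "\<exists>v0 R. R > 0 \<and> emeasure lebesgue ((E - cball v0 R) \<union> (cball v0 R - E)) = 0"
proof -
  obtain S N N' where SN: "E = S \<union> N" "N \<subseteq> N'" "N' \<in> null_sets lborel" "S \<in> sets lborel"
    by (rule sets_completionE[OF assms(2)])
  have S: "S \<in> sets borel" using SN(4) by simp
  have "AE x in lborel. x \<notin> N'" by (rule AE_not_in[OF SN(3)])
  then have ES: "AE x in lborel. x \<in> E \<longleftrightarrow> x \<in> S"
    by (rule eventually_mono) (use SN(1,2) in auto)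
  have "emeasure lebesgue E = emeasure lebesgue S"
    using ES S assms(2) by (intro emeasure_eq_AE) (auto simp: AE_completion_iff)
  then have mS: "emeasure lebesgue E = emeasure lborel S" using S by simp
  have "crossing_free S"
    by (rule collision_hypothesis_imp_crossing_free[OF assms(5) S _ ES]) (use assms(4) mS in simp)
  have "DIM(real ^ 'n) \<ge> 2" "emeasure lborel S < \<infinity>" "emeasure lborel S \<noteq> 0"
    using assms(1,3,4) mS by auto
  from crossing_free_imp_ball[OF this(1) S this(2,3) \<open>crossing_free S\<close>]
  obtain c r where cr: "r > 0" "AE x in lborel. x \<in> S \<longleftrightarrow> x \<in> cball c r" by blast
  have "AE x in lborel. x \<notin> (E - cball c r) \<union> (cball c r - E)"
    using ES cr(2) by eventually_elim auto
  then have "AE x in lebesgue. x \<notin> (E - cball c r) \<union> (cball c r - E)"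
    by (simp only: AE_completion_iff)
  moreover have "(E - cball c r) \<union> (cball c r - E) \<in> sets lebesgue"
    using assms(2) by (intro sets.Un sets.Diff) auto
  ultimately have "(E - cball c r) \<union> (cball c r - E) \<in> null_sets lebesgue"
    by (simp only: AE_iff_null_sets)
  then show ?thesis using cr(1) by (intro exI[of _ c] exI[of _ r]) (simp add: null_sets_def)
qed

end
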